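(* Let $(a,b,c)\in\mathbb R^3\setminus\{(0,0,0)\}$ and let $p\in(0,1)$. If $p>0.25$, then $\mathrm{proj}_{(a,b,c)}(\mathcal M_p)$ contains an interval almost surely conditioned on non-extinction.
   Context: Projection: $\mathrm{proj}_{(a,b,c)}:\mathbb R^3\to\mathbb R$, $\mathrm{proj}_{(a,b,c)}(x,y,z)=ax+by+cz$. "Interval" means nondegenerate interval. Random Menger sponge: let $T$ be the set of the $20$ vectors obtained from $\{0,\frac13,\frac23\}^3$ by removing the $7$ vectors having at least two coordinates equal to $\frac13$. Let $f_t(x)=\frac13x+t$ on $\mathbb R^3$ for $t\in T$, and $f_{t_1\dots t_n}=f_{t_1}\circ\dots\circ f_{t_n}$. Give each nonempty finite word over $T$ an independent Bernoulli($p$) label, and let $\mathcal E_n\subset T^n$ be the random set of words $t_1\dots t_n$ such that all of $t_1,\ t_1t_2,\dots,\ t_1\dots t_n$ have label $1$. Then $\mathcal M_p:=\bigcap_{n\ge1}\bigcup_{\mathbf t\in\mathcal E_n}f_{\mathbf t}([0,1]^3)$. Non-extinction is the event that $\mathcal E_n\neq\emptyset$ for all $n$; a property holds "almost surely conditioned on non-extinction" if the event that non-extinction occurs and the property fails has probability $0$. *)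

theory Defs
  imports "HOL-Analysis.Analysis" "HOL-Probability.Probability"
begin

definition menger_digits :: "(real^3) set" where
  "menger_digits =
     {t. \<forall>i. t $ i \<in> {0, 1/3, 2/3}} - {t. card {i. t $ i = 1/3} \<ge> 2}"

definition menger_map :: "real^3 \<Rightarrow> real^3 \<Rightarrow> real^3" where
  "menger_map t x = (1/3) *\<^sub>R x + t"

definition menger_word_map :: "(real^3) list \<Rightarrow> real^3 \<Rightarrow> real^3" where
  "menger_word_map w = foldr (\<lambda>t g. menger_map t \<circ> g) w id"

definition menger_words :: "(real^3) list set" where
  "menger_words = {w. w \<noteq> [] \<and> set w \<subseteq> menger_digits}"

text \<open>In the next three definitions \<open>L\<close> is one realisation of the labels; its values
  outside \<^const>\<open>menger_words\<close> are never used.\<close>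

definition surviving_words :: "((real^3) list \<Rightarrow> bool) \<Rightarrow> nat \<Rightarrow> (real^3) list set" where
  "surviving_words L n =
     {w. length w = n \<and> set w \<subseteq> menger_digits \<and> (\<forall>k\<in>{1..n}. L (take k w))}"

definition menger_sponge :: "((real^3) list \<Rightarrow> bool) \<Rightarrow> (real^3) set" where
  "menger_sponge L = (\<Inter>n\<in>{1..}. \<Union>w\<in>surviving_words L n. menger_word_map w ` cbox 0 1)"

definition non_extinct :: "((real^3) list \<Rightarrow> bool) \<Rightarrow> bool" where
  "non_extinct L \<longleftrightarrow> (\<forall>n. surviving_words L n \<noteq> {})"

definition bernoulli_labelling ::
  "'w measure \<Rightarrow> real \<Rightarrow> ((real^3) list \<Rightarrow> 'w \<Rightarrow> bool) \<Rightarrow> bool" where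
  "bernoulli_labelling M p X \<longleftrightarrow>
     prob_space.indep_vars M (\<lambda>_. count_space UNIV) X menger_words \<and>
     (\<forall>w\<in>menger_words. distr M (count_space UNIV) (X w) = measure_pmf (bernoulli_pmf p))"

definition proj :: "real \<times> real \<times> real \<Rightarrow> real^3 \<Rightarrow> real" where
  "proj = (\<lambda>(a, b, c) v. a * v $ 1 + b * v $ 2 + c * v $ 3)"

definition contains_interval :: "real set \<Rightarrow> bool" where
  "contains_interval S \<longleftrightarrow>
     (\<exists>I. is_interval I \<and> (\<exists>x\<in>I. \<exists>y\<in>I. x \<noteq> y) \<and> I \<subseteq> S)"

end

theory Submission
  imports Defs "HOL-Real_Asymp.Real_Asymp"
begin

text \<open>
  Every direction admits a window \<open>I\<close> inside the projection of the unit cube such that each point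
  of \<open>I\<close> lies in at least four of the 20 first-level copies of \<open>I\<close>. (For a coordinate direction, four
  is the number of subcubes in the middle slab.) Hence the number of surviving copies of \<open>I\<close> of
  level \<open>n\<close> that contain a given point \<open>x\<close> of \<open>I\<close> has conditional mean growth at least \<open>4 * p > 1\<close>. If it
  exceeds \<open>lam ^ n\<close>, where \<open>1 < lam < 4 * p\<close>, then by Hoeffding's inequality it fails to grow by the
  factor \<open>lam\<close> with a probability that is doubly exponentially small in \<open>n\<close>, whereas points of \<open>I\<close>
  have only exponentially many patterns of level \<open>n\<close>. So with positive probability all points of \<open>I\<close>
  stay covered at all levels, and by compactness \<open>I\<close> is contained in the projection of the sponge.
  Finally, the probability that no surviving cube has such a subtree is at most the extinction
  probability, because both are governed by the generating function \<open>(1 - p + p * s) ^ 20\<close>.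
\<close>

section \<open>Fourfold coverage of the projected window\<close>

text \<open>A digit \<open>t\<close> is encoded as \<open>e = 3 * t - 1\<close>, and the projected line is rescaled by 3 about
  the centre of the projected cube, so that the projected subcubes become intervals centred at
  the numbers \<open>e \<bullet> (a, b, c)\<close>.\<close>

definition signs :: "(int \<times> int \<times> int) set" where
  "signs = {(i, j, k). \<bar>i\<bar> \<le> 1 \<and> \<bar>j\<bar> \<le> 1 \<and> \<bar>k\<bar> \<le> 1 \<and>
      (i \<noteq> 0 \<or> j \<noteq> 0) \<and> (i \<noteq> 0 \<or> k \<noteq> 0) \<and> (j \<noteq> 0 \<or> k \<noteq> 0)}"

definition sign_cover :: "real \<Rightarrow> real \<Rightarrow> real \<Rightarrow> real \<Rightarrow> real \<Rightarrow> (int \<times> int \<times> int) set" where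
  "sign_cover a b c \<rho> z =
     {(i, j, k) \<in> signs. \<bar>z - (of_int i * a + of_int j * b + of_int k * c)\<bar> \<le> \<rho>}"

lemma finite_signs: "finite signs"
proof (rule finite_subset)
  show "signs \<subseteq> {-1..1} \<times> {-1..1} \<times> {-1..1}"
    by (auto simp: signs_def)
qed simp

text \<open>Every symmetry used below (sign changes and permutations of the direction, reflection of
  \<open>z\<close>) permutes the sign vectors and preserves their distances to the point, so it
  embeds one cover into the other. An inequality suffices, since only lower bounds on covers are
  wanted.\<close>

lemma sign_cover_le:
  assumes "bij_betw g signs signs"
    and "\<And>i j k i' j' k'. (i, j, k) \<in> signs \<Longrightarrow> g (i, j, k) = (i', j', k') \<Longrightarrow>
      \<bar>z - (of_int i * a + of_int j * b + of_int k * c)\<bar> =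
      \<bar>z' - (of_int i' * a' + of_int j' * b' + of_int k' * c')\<bar>"
  shows "card (sign_cover a b c \<rho> z) \<le> card (sign_cover a' b' c' \<rho> z')"
proof (rule card_inj_on_le[of g])
  show "inj_on g (sign_cover a b c \<rho> z)"
    using assms(1) by (rule bij_betw_imp_inj_on[THEN inj_on_subset]) (auto simp: sign_cover_def)
  show "finite (sign_cover a' b' c' \<rho> z')"
    by (rule finite_subset[OF _ finite_signs]) (auto simp: sign_cover_def)
  show "g ` sign_cover a b c \<rho> z \<subseteq> sign_cover a' b' c' \<rho> z'"
  proof (safe intro!: image_subsetI)
    fix i j k assume e: "(i, j, k) \<in> sign_cover a b c \<rho> z"
    obtain i' j' k' where e': "g (i, j, k) = (i', j', k')" by (cases "g (i, j, k)")
    have "(i, j, k) \<in> signs" using e by (simp add: sign_cover_def)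
    moreover from this have "(i', j', k') \<in> signs"
      using e' assms(1) by (metis bij_betwE)
    ultimately show "g (i, j, k) \<in> sign_cover a' b' c' \<rho> z'"
      using assms(2)[OF _ e'] e unfolding e' by (simp add: sign_cover_def)
  qed
qed

section \<open>Invariance under permutations and sign changes of the direction\<close>

lemma bij_betw_involution:
  assumes "\<And>x. x \<in> S \<Longrightarrow> g x \<in> S" "\<And>x. x \<in> S \<Longrightarrow> g (g x) = x"
  shows "bij_betw g S S"
  using assms by (intro bij_betw_byWitness[where f' = g]) auto

lemma bij_signs:
  shows bij_signs_neg1: "bij_betw (\<lambda>(i, j, k). (-i, j, k)) signs signs"
    and bij_signs_swap12: "bij_betw (\<lambda>(i, j, k). (j, i, k)) signs signs"
    and bij_signs_swap23: "bij_betw (\<lambda>(i, j, k). (i, k, j)) signs signs"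
    and bij_signs_neg: "bij_betw (\<lambda>(i, j, k). (-i, -j, -k)) signs signs"
  by (rule bij_betw_involution; force simp: signs_def)+

text \<open>The window has length \<open>2 * \<rho>\<close> and the projected cube has length
  \<open>\<bar>a\<bar> + \<bar>b\<bar> + \<bar>c\<bar>\<close>, so the window fits inside. The range
  \<open>3 * \<rho>\<close> for \<open>z\<close> is the window magnified by 3, the scale on which
  the windows of the subcubes have radius \<open>\<rho>\<close>.\<close>

definition robust :: "real \<Rightarrow> real \<Rightarrow> real \<Rightarrow> bool" where
  "robust a b c \<longleftrightarrow> (\<exists>\<rho>>0. 2 * \<rho> \<le> \<bar>a\<bar> + \<bar>b\<bar> + \<bar>c\<bar> \<and>
     (\<forall>z. \<bar>z\<bar> \<le> 3 * \<rho> \<longrightarrow> 4 \<le> card (sign_cover a b c \<rho> z)))"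

lemma robust_uminus: assumes "robust (-a) b c" shows "robust a b c"
proof -
  have le: "card (sign_cover (-a) b c \<rho> z) \<le> card (sign_cover a b c \<rho> z)" for \<rho> z
    by (rule sign_cover_le[OF bij_signs(1)]) auto
  from assms obtain \<rho> where "\<rho> > 0" "2 * \<rho> \<le> \<bar>a\<bar> + \<bar>b\<bar> + \<bar>c\<bar>"
    "\<forall>z. \<bar>z\<bar> \<le> 3 * \<rho> \<longrightarrow> 4 \<le> card (sign_cover (-a) b c \<rho> z)"
    by (auto simp: robust_def)
  with le show ?thesis unfolding robust_def by (meson order_trans)
qed

lemma robust_swap12: assumes "robust b a c" shows "robust a b c"
proof -
  have le: "card (sign_cover b a c \<rho> z) \<le> card (sign_cover a b c \<rho> z)" for \<rho> z
    by (rule sign_cover_le[OF bij_signs(2)]) (auto simp: algebra_simps)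
  from assms obtain \<rho> where "\<rho> > 0" "2 * \<rho> \<le> \<bar>a\<bar> + \<bar>b\<bar> + \<bar>c\<bar>"
    "\<forall>z. \<bar>z\<bar> \<le> 3 * \<rho> \<longrightarrow> 4 \<le> card (sign_cover b a c \<rho> z)"
    by (auto simp: robust_def)
  with le show ?thesis unfolding robust_def by (meson order_trans)
qed

lemma robust_swap23: assumes "robust a c b" shows "robust a b c"
proof -
  have le: "card (sign_cover a c b \<rho> z) \<le> card (sign_cover a b c \<rho> z)" for \<rho> z
    by (rule sign_cover_le[OF bij_signs(3)]) (auto simp: algebra_simps)
  from assms obtain \<rho> where "\<rho> > 0" "2 * \<rho> \<le> \<bar>a\<bar> + \<bar>b\<bar> + \<bar>c\<bar>"
    "\<forall>z. \<bar>z\<bar> \<le> 3 * \<rho> \<longrightarrow> 4 \<le> card (sign_cover a c b \<rho> z)"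
    by (auto simp: robust_def)
  with le show ?thesis unfolding robust_def by (meson order_trans)
qed

section \<open>Sorted nonnegative directions\<close>

lemma four_le_sign_cover:
  assumes "D \<subseteq> sign_cover a b c \<rho> z" "card D = 4"
  shows "4 \<le> card (sign_cover a b c \<rho> z)"
proof -
  have "finite (sign_cover a b c \<rho> z)"
    by (rule finite_subset[OF _ finite_signs]) (auto simp: sign_cover_def)
  from card_mono[OF this assms(1)] assms(2) show ?thesis by simp
qed

text \<open>Writing the radius as \<open>r / 2\<close> and doubling removes absolute values and
  fractions, so that membership becomes a pair of linear inequalities with integer
  coefficients.\<close>

lemma mem_sign_cover_half:
  "(i, j, k) \<in> sign_cover a b c (r / 2) z \<longleftrightarrow> (i, j, k) \<in> signs \<and>
    2 * z - 2 * (of_int i * a + of_int j * b + of_int k * c) \<le> r \<and>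
    2 * (of_int i * a + of_int j * b + of_int k * c) - 2 * z \<le> r"
proof -
  have "\<bar>z - x\<bar> \<le> r / 2 \<longleftrightarrow> 2 * z - 2 * x \<le> r \<and> 2 * x - 2 * z \<le> r" for x
    by argo
  then show ?thesis by (simp add: sign_cover_def)
qed

text \<open>The window length \<open>2 * \<rho>\<close> has to be at most the fourth largest of the numbers
  \<open>e \<bullet> (a, b, c)\<close>, or else the end \<open>z = 3 * \<rho>\<close> is not covered four times. This largest possible
  choice works: it is \<open>a + c\<close> if \<open>2 * a \<le> b\<close>, and \<open>max (b + c - a) (a + b)\<close> otherwise. The quadruples
  below were found by a computer search.\<close>

lemma sign_cover_sorted1:
  assumes "0 \<le> a" "a \<le> b" "b \<le> c" "2 * a \<le> b" "0 \<le> z" "2 * z \<le> 3 * (a + c)"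
  shows "4 \<le> card (sign_cover a b c ((a + c) / 2) z)"
proof -
  define P where "P x \<longleftrightarrow> 2 * z - 2 * x \<le> a + c \<and> 2 * x - 2 * z \<le> a + c" for x
  \<comment> \<open>Each alternative lists the centres of four distinct sign vectors, all within
    \<open>(a + c) / 2\<close> of \<open>z\<close>. That one of the alternatives always holds is
    pure linear arithmetic in \<open>a\<close>, \<open>b\<close>, \<open>c\<close>,
    \<open>z\<close>.\<close>
  consider
      "P (- a + b)" "P (- b + c)" "P (a - b + c)" "P (a + b - c)"
    | "P (- a - b + c)" "P (- a + b)" "P (- b + c)" "P (a + b)"
    | "P (- a - b + c)" "P (- b + c)" "P (b - c)" "P (a + b - c)"
    | "P (- a + b + c)" "P (b + c)" "P (a + c)" "P (a + b)"
    | "P (- a - b)" "P (- a + b)" "P (a - b)" "P (a + b)"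
    | "P (- a + c)" "P (- a + b)" "P (a + c)" "P (a + b)"
    | "P (- a + b + c)" "P (b + c)" "P (a + c)" "P (a + b + c)"
    using assms unfolding P_def by argo
  then show ?thesis
  proof cases
    case 1
    then show ?thesis
      by (intro four_le_sign_cover[of "{(-1, 1, 0), (0, -1, 1), (1, -1, 1), (1, 1, -1)}"])
         (auto simp: mem_sign_cover_half signs_def P_def algebra_simps)
  next
    case 2
    then show ?thesis
      by (intro four_le_sign_cover[of "{(-1, -1, 1), (-1, 1, 0), (0, -1, 1), (1, 1, 0)}"])
         (auto simp: mem_sign_cover_half signs_def P_def algebra_simps)
  next
    case 3
    then show ?thesis
      by (intro four_le_sign_cover[of "{(-1, -1, 1), (0, -1, 1), (0, 1, -1), (1, 1, -1)}"])
         (auto simp: mem_sign_cover_half signs_def P_def algebra_simps)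
  next
    case 4
    then show ?thesis
      by (intro four_le_sign_cover[of "{(-1, 1, 1), (0, 1, 1), (1, 0, 1), (1, 1, 0)}"])
         (auto simp: mem_sign_cover_half signs_def P_def algebra_simps)
  next
    case 5
    then show ?thesis
      by (intro four_le_sign_cover[of "{(-1, -1, 0), (-1, 1, 0), (1, -1, 0), (1, 1, 0)}"])
         (auto simp: mem_sign_cover_half signs_def P_def algebra_simps)
  next
    case 6
    then show ?thesis
      by (intro four_le_sign_cover[of "{(-1, 0, 1), (-1, 1, 0), (1, 0, 1), (1, 1, 0)}"])
         (auto simp: mem_sign_cover_half signs_def P_def algebra_simps)
  next
    case 7
    then show ?thesis
      by (intro four_le_sign_cover[of "{(-1, 1, 1), (0, 1, 1), (1, 0, 1), (1, 1, 1)}"])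
         (auto simp: mem_sign_cover_half signs_def P_def algebra_simps)
  qed
qed

lemma sign_cover_sorted2:
  assumes "0 \<le> a" "a \<le> b" "b \<le> c" "b \<le> 2 * a" "0 \<le> z" "2 * z \<le> 3 * r"
    and "b + c - a \<le> r" "a + b \<le> r" "r = b + c - a \<or> r = a + b"
  shows "4 \<le> card (sign_cover a b c (r / 2) z)"
proof -
  define P where "P x \<longleftrightarrow> 2 * z - 2 * x \<le> r \<and> 2 * x - 2 * z \<le> r" for x
  \<comment> \<open>The hypotheses on \<open>r\<close> make it the maximum of
    \<open>b + c - a\<close> and \<open>a + b\<close>, in a form open to linear arithmetic.\<close>
  consider
      "P (- a + c)" "P (- a + b + c)" "P (a - b + c)" "P (a + b)"
    | "P (- a + c)" "P (- a + b)" "P (- b + c)" "P (a - b + c)"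
    | "P (- a + b + c)" "P (b + c)" "P (a + c)" "P (a + b + c)"
    | "P (b + c)" "P (a + c)" "P (a + b)" "P (a + b + c)"
    | "P (- a - b + c)" "P (- a + b)" "P (a - b)" "P (a + b - c)"
    | "P (- a - b + c)" "P (- a + b)" "P (a - b)" "P (a + b)"
    | "P (- a - b)" "P (- a + b)" "P (a - b)" "P (a + b)"
    | "P (- a + b + c)" "P (b + c)" "P (a + c)" "P (a + b)"
    using assms unfolding P_def by argo
  then show ?thesis
  proof cases
    case 1
    then show ?thesis
      by (intro four_le_sign_cover[of "{(-1, 0, 1), (-1, 1, 1), (1, -1, 1), (1, 1, 0)}"])
         (auto simp: mem_sign_cover_half signs_def P_def algebra_simps)
  next
    case 2
    then show ?thesis
      by (intro four_le_sign_cover[of "{(-1, 0, 1), (-1, 1, 0), (0, -1, 1), (1, -1, 1)}"])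
         (auto simp: mem_sign_cover_half signs_def P_def algebra_simps)
  next
    case 3
    then show ?thesis
      by (intro four_le_sign_cover[of "{(-1, 1, 1), (0, 1, 1), (1, 0, 1), (1, 1, 1)}"])
         (auto simp: mem_sign_cover_half signs_def P_def algebra_simps)
  next
    case 4
    then show ?thesis
      by (intro four_le_sign_cover[of "{(0, 1, 1), (1, 0, 1), (1, 1, 0), (1, 1, 1)}"])
         (auto simp: mem_sign_cover_half signs_def P_def algebra_simps)
  next
    case 5
    then show ?thesis
      by (intro four_le_sign_cover[of "{(-1, -1, 1), (-1, 1, 0), (1, -1, 0), (1, 1, -1)}"])
         (auto simp: mem_sign_cover_half signs_def P_def algebra_simps)
  next
    case 6
    then show ?thesis
      by (intro four_le_sign_cover[of "{(-1, -1, 1), (-1, 1, 0), (1, -1, 0), (1, 1, 0)}"])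
         (auto simp: mem_sign_cover_half signs_def P_def algebra_simps)
  next
    case 7
    then show ?thesis
      by (intro four_le_sign_cover[of "{(-1, -1, 0), (-1, 1, 0), (1, -1, 0), (1, 1, 0)}"])
         (auto simp: mem_sign_cover_half signs_def P_def algebra_simps)
  next
    case 8
    then show ?thesis
      by (intro four_le_sign_cover[of "{(-1, 1, 1), (0, 1, 1), (1, 0, 1), (1, 1, 0)}"])
         (auto simp: mem_sign_cover_half signs_def P_def algebra_simps)
  qed
qed

lemma robust_sorted:
  assumes "0 \<le> a" "a \<le> b" "b \<le> c" "0 < c"
  shows "robust a b c"
proof -
  have "\<exists>r>0. r \<le> a + b + c \<and>
    (\<forall>z. 0 \<le> z \<and> 2 * z \<le> 3 * r \<longrightarrow> 4 \<le> card (sign_cover a b c (r / 2) z))"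
  proof (cases "2 * a \<le> b")
    case True
    with assms show ?thesis by (intro exI[of _ "a + c"]) (auto intro: sign_cover_sorted1)
  next
    case False
    with assms show ?thesis
      by (intro exI[of _ "max (b + c - a) (a + b)"]) (auto intro!: sign_cover_sorted2 simp: max_def)
  qed
  then obtain r where r: "r > 0" "r \<le> a + b + c"
    and nonneg: "\<And>z. 0 \<le> z \<Longrightarrow> 2 * z \<le> 3 * r \<Longrightarrow> 4 \<le> card (sign_cover a b c (r / 2) z)"
    by blast
  \<comment> \<open>Replacing each sign vector by its negative reflects the picture in 0, so
    negative \<open>z\<close> reduce to nonnegative ones.\<close>
  have "4 \<le> card (sign_cover a b c (r / 2) z)" if "\<bar>z\<bar> \<le> 3 * (r / 2)" for z
  proof -
    have "card (sign_cover a b c (r / 2) (-z)) \<le> card (sign_cover a b c (r / 2) z)"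
      by (rule sign_cover_le[OF bij_signs_neg]) auto
    with nonneg[of z] nonneg[of "-z"] that show ?thesis by (cases "0 \<le> z") auto
  qed
  with r assms show ?thesis unfolding robust_def by (intro exI[of _ "r / 2"]) auto
qed

section \<open>Arbitrary nonzero directions\<close>

lemma robust_nonneg:
  assumes "0 \<le> a" "0 \<le> b" "0 \<le> c" "(a, b, c) \<noteq> (0, 0, 0)"
  shows "robust a b c"
proof -
  have *: "robust x y z" if "x \<le> y" "0 \<le> x" "0 \<le> y" "0 \<le> z" "(x, y, z) \<noteq> (0, 0, 0)" for x y z
  proof -
    consider "y \<le> z" | "x \<le> z" "z \<le> y" | "z \<le> x" using that by linarith
    then show ?thesis
    proof cases
      case 1
      with that show ?thesis by (intro robust_sorted) auto
    next
      case 2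
      with that have "robust x z y" by (intro robust_sorted) auto
      then show ?thesis by (rule robust_swap23)
    next
      case 3
      with that have "robust z x y" by (intro robust_sorted) auto
      then show ?thesis by (rule robust_swap23[OF robust_swap12])
    qed
  qed
  show ?thesis
    using *[of a b c] *[of b a c] assms robust_swap12[of b a c] by (cases "a \<le> b") auto
qed

theorem robust_nonzero:
  assumes "(a, b, c) \<noteq> (0, 0, 0)"
  shows "robust a b c"
proof -
  have abs1: "robust x y z" if "robust \<bar>x\<bar> y z" for x y z
    using that robust_uminus[of x y z] by (cases "x \<ge> 0") auto
  \<comment> \<open>\<open>abs1\<close> acts on the first coordinate only, so transpositions bring
    each coordinate to the front in turn.\<close>
  have "robust \<bar>c\<bar> \<bar>a\<bar> \<bar>b\<bar>" using assms by (intro robust_nonneg) auto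
  then have "robust c \<bar>a\<bar> \<bar>b\<bar>" by (rule abs1)
  then have "robust \<bar>b\<bar> \<bar>a\<bar> c" by (rule robust_swap12[OF robust_swap23[OF robust_swap12]])
  then have "robust b \<bar>a\<bar> c" by (rule abs1)
  then have "robust \<bar>a\<bar> b c" by (rule robust_swap12)
  then show ?thesis by (rule abs1)
qed

section \<open>Words and the projected sponge\<close>

lemma finite_menger_digits: "finite menger_digits"
proof (rule finite_subset)
  show "menger_digits \<subseteq> (\<lambda>f. \<chi> i. f i) ` (UNIV \<rightarrow>\<^sub>E {0, 1/3, 2/3})"
  proof
    fix t assume "t \<in> menger_digits"
    then show "t \<in> (\<lambda>f. \<chi> i. f i) ` (UNIV \<rightarrow>\<^sub>E {0, 1/3, 2/3})"
      by (intro image_eqI[of _ _ "($) t"]) (auto simp: menger_digits_def PiE_iff)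
  qed
qed (intro finite_imageI finite_PiE; simp)

definition sign_digit :: "int \<times> int \<times> int \<Rightarrow> real^3" where
  "sign_digit = (\<lambda>(i, j, k). vector [(1 + of_int i) / 3, (1 + of_int j) / 3, (1 + of_int k) / 3])"

lemma inj_sign_digit: "inj sign_digit"
  by (auto simp: inj_def sign_digit_def vec_eq_iff forall_3)

lemma sign_digit_mem:
  assumes "e \<in> signs"
  shows "sign_digit e \<in> menger_digits"
proof -
  obtain i j k where e: "e = (i, j, k)" by (cases e)
  have "card {n. sign_digit e $ n = 1/3} \<le> Suc 0"
  proof -
    have "(1 + real_of_int l) / 3 = 1 / 3 \<longleftrightarrow> l = 0" for l by (simp add: field_simps)
    then have "{n. sign_digit e $ n = 1/3} = {n. n = 1 \<and> i = 0 \<or> n = 2 \<and> j = 0 \<or> n = 3 \<and> k = 0}"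
    proof (intro set_eqI)
      fix n :: 3
      show "n \<in> {n. sign_digit e $ n = 1/3} \<longleftrightarrow>
          n \<in> {n. n = 1 \<and> i = 0 \<or> n = 2 \<and> j = 0 \<or> n = 3 \<and> k = 0}"
        using exhaust_3[of n] \<open>\<And>l. _ \<longleftrightarrow> l = 0\<close> by (elim disjE) (simp_all add: e sign_digit_def)
    qed
    then show ?thesis using assms
      by (auto simp: e signs_def card_le_Suc0_iff_eq[OF finite])
  qed
  moreover have "sign_digit e $ n \<in> {0, 1/3, 2/3}" for n
  proof -
    have "l = -1 \<or> l = 0 \<or> l = 1" if "\<bar>l\<bar> \<le> 1" for l :: int using that by arith
    then have "\<forall>l\<in>{i, j, k}. l = -1 \<or> l = 0 \<or> l = 1"
      using assms by (auto simp: e signs_def)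
    then show ?thesis using exhaust_3[of n] by (auto simp: e sign_digit_def)
  qed
  ultimately show ?thesis by (simp add: menger_digits_def)
qed

section \<open>Projection and word maps\<close>

lemma proj_linear: "linear (proj (a, b, c))"
  by (rule linearI) (auto simp: proj_def algebra_simps)

lemma proj_sign_digit:
  "3 * proj (a, b, c) (sign_digit (i, j, k)) = a + b + c + (of_int i * a + of_int j * b + of_int k * c)"
  by (simp add: proj_def sign_digit_def algebra_simps add_divide_distrib)

lemma menger_word_map_Nil [simp]: "menger_word_map [] = id"
  and menger_word_map_Cons [simp]: "menger_word_map (t # w) = menger_map t \<circ> menger_word_map w"
  by (auto simp: menger_word_map_def)

lemma menger_word_map_affine:
  "menger_word_map w x = (1/3) ^ length w *\<^sub>R x + menger_word_map w 0"
  by (induction w) (auto simp: menger_map_def scaleR_add_right)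

lemma menger_word_map_append: "menger_word_map (v @ w) = menger_word_map v \<circ> menger_word_map w"
  by (induction v) auto

lemma menger_map_cbox:
  assumes "t \<in> menger_digits" "x \<in> cbox 0 1"
  shows "menger_map t x \<in> cbox 0 1"
proof -
  have "0 \<le> x $ i / 3 + t $ i \<and> x $ i / 3 + t $ i \<le> 1" for i
  proof -
    have "t $ i = 0 \<or> t $ i = 1/3 \<or> t $ i = 2/3" using assms(1) by (simp add: menger_digits_def)
    moreover have "0 \<le> x $ i \<and> x $ i \<le> 1" using assms(2) by (simp add: mem_box_cart)
    ultimately show ?thesis by argo
  qed
  then show ?thesis by (auto simp: menger_map_def mem_box_cart)
qed

lemma menger_word_map_cbox:
  "set w \<subseteq> menger_digits \<Longrightarrow> x \<in> cbox 0 1 \<Longrightarrow> menger_word_map w x \<in> cbox 0 1"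
  by (induction w) (auto intro: menger_map_cbox)

section \<open>Surviving words and subtrees\<close>

lemma surviving_words_take:
  assumes "w \<in> surviving_words L n" "m \<le> n"
  shows "take m w \<in> surviving_words L m"
  using assms by (auto simp: surviving_words_def min_def dest: in_set_takeD)

definition words :: "nat \<Rightarrow> (real^3) list set" where
  "words n = {w. set w \<subseteq> menger_digits \<and> length w = n}"

lemma finite_words: "finite (words n)"
  unfolding words_def by (rule finite_lists_length_eq[OF finite_menger_digits])

lemma surviving_words_subset: "surviving_words L n \<subseteq> words n"
  by (auto simp: surviving_words_def words_def)

lemma finite_surviving_words: "finite (surviving_words L n)"
  by (rule finite_subset[OF surviving_words_subset finite_words])

lemma surviving_words_0 [simp]: "surviving_words L 0 = {[]}"
  by (auto simp: surviving_words_def)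

lemma surviving_words_Suc_snoc:
  "surviving_words L (Suc n) =
    {w @ [t] | w t. w \<in> surviving_words L n \<and> t \<in> menger_digits \<and> L (w @ [t])}"
  (is "?l = ?r")
proof (intro set_eqI iffI)
  fix v assume v: "v \<in> ?l"
  then obtain w t where wt: "v = w @ [t]"
    by (cases v rule: rev_cases) (auto simp: surviving_words_def)
  have "L (take k w)" if "k \<in> {1..n}" for k
    using v that wt by (auto simp: surviving_words_def dest!: bspec[of _ _ k])
  moreover have "L v" using v by (auto simp: surviving_words_def dest!: bspec[of _ _ "Suc n"])
  ultimately show "v \<in> ?r" using v wt by (auto simp: surviving_words_def)
next
  fix v assume "v \<in> ?r"
  then obtain w t where wt: "v = w @ [t]" "w \<in> surviving_words L n" "t \<in> menger_digits" "L (w @ [t])"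
    by blast
  have "L (take k v)" if "k \<in> {1..Suc n}" for k
    using wt that by (cases "k = Suc n") (auto simp: surviving_words_def)
  with wt show "v \<in> ?l" by (auto simp: surviving_words_def)
qed

text \<open>Splitting off the first letter exhibits the subtree below \<open>t\<close> as a
  labelling of its own, \<open>\<lambda>v. L (t # v)\<close>. There \<open>L [t]\<close> sits at the
  empty word, which \<open>surviving_words\<close> never consults, so it appears as a separate
  condition.\<close>

lemma surviving_words_Suc_Cons:
  "surviving_words L (Suc n) =
    {t # w | t w. t \<in> menger_digits \<and> L [t] \<and> w \<in> surviving_words (\<lambda>v. L (t # v)) n}"
  (is "?l = ?r")
proof (intro set_eqI iffI)
  fix v assume v: "v \<in> ?l"
  then obtain t w where wt: "v = t # w"
    by (cases v) (auto simp: surviving_words_def)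
  have "L (take (Suc k) v)" if "k \<in> {0..n}" for k
    using v that by (auto simp: surviving_words_def)
  then have "L (t # take k w)" if "k \<in> {0..n}" for k
    using that wt by simp
  from this this[of 0] show "v \<in> ?r" using v wt by (auto simp: surviving_words_def)
next
  fix v assume "v \<in> ?r"
  then obtain t w where wt: "v = t # w" "t \<in> menger_digits" "L [t]"
      "w \<in> surviving_words (\<lambda>v. L (t # v)) n"
    by blast
  have "L (take k v)" if k: "k \<in> {1..Suc n}" for k
  proof -
    from k obtain m where "k = Suc m" "m \<le> n" by (cases k) auto
    with wt show ?thesis by (cases "m = 0") (auto simp: surviving_words_def)
  qed
  with wt show "v \<in> ?l" by (auto simp: surviving_words_def)
qed

text \<open>If every subtree below a digit with label 1 dies out, finiteness of
  \<open>menger_digits\<close> gives a common level at which all of them are dead, and the whole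
  tree is dead one level later. Conversely, a surviving word of a subtree survives with
  \<open>t\<close> prefixed.\<close>

lemma non_extinct_step:
  "non_extinct L \<longleftrightarrow> (\<exists>t\<in>menger_digits. L [t] \<and> non_extinct (\<lambda>v. L (t # v)))"
proof
  assume "non_extinct L"
  show "\<exists>t\<in>menger_digits. L [t] \<and> non_extinct (\<lambda>v. L (t # v))"
  proof (rule ccontr)
    assume "\<not> ?thesis"
    then have "\<forall>t\<in>menger_digits. \<exists>n. L [t] \<longrightarrow> surviving_words (\<lambda>v. L (t # v)) n = {}"
      by (auto simp: non_extinct_def)
    then obtain N where N: "\<And>t. t \<in> menger_digits \<Longrightarrow> L [t] \<Longrightarrow> surviving_words (\<lambda>v. L (t # v)) (N t) = {}"
      by metis
    define m where "m = Max (insert 0 (N ` menger_digits))"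
    have "N t \<le> m" if "t \<in> menger_digits" for t
      using that finite_menger_digits by (auto simp: m_def)
    then have "surviving_words (\<lambda>v. L (t # v)) m = {}" if "t \<in> menger_digits" "L [t]" for t
      using N[OF that] that surviving_words_take by blast
    then have "surviving_words L (Suc m) = {}" by (auto simp: surviving_words_Suc_Cons)
    with \<open>non_extinct L\<close> show False by (simp add: non_extinct_def)
  qed
next
  assume "\<exists>t\<in>menger_digits. L [t] \<and> non_extinct (\<lambda>v. L (t # v))"
  then have "surviving_words L n \<noteq> {}" for n
    by (cases n) (fastforce simp: surviving_words_Suc_Cons non_extinct_def)+
  then show "non_extinct L" by (simp add: non_extinct_def)
qed

lemma menger_map_menger_sponge:
  assumes "t \<in> menger_digits" "L [t]" "x \<in> menger_sponge (\<lambda>v. L (t # v))"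
  shows "menger_map t x \<in> menger_sponge L"
  unfolding menger_sponge_def
proof (intro INT_I)
  fix n :: nat assume "n \<in> {1..}"
  then obtain m where n: "n = Suc m" by (cases n) auto
  have "x \<in> (\<Union>w\<in>surviving_words (\<lambda>v. L (t # v)) m. menger_word_map w ` cbox 0 1)"
  proof (cases m)
    \<comment> \<open>\<open>menger_sponge\<close> intersects from level 1 on, so the level-0 fact
      that \<open>x\<close> lies in the unit cube is read off from level 1.\<close>
    case 0
    have "x \<in> (\<Union>w\<in>surviving_words (\<lambda>v. L (t # v)) 1. menger_word_map w ` cbox 0 1)"
      using assms(3) unfolding menger_sponge_def by blast
    then have "x \<in> cbox 0 1"
      by (auto simp: surviving_words_def intro: menger_word_map_cbox)
    with 0 show ?thesis by simp
  next
    case (Suc k)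
    then show ?thesis using assms(3) unfolding menger_sponge_def by auto
  qed
  then obtain w y where wy: "w \<in> surviving_words (\<lambda>v. L (t # v)) m" "y \<in> cbox 0 1" "x = menger_word_map w y"
    by blast
  then have "t # w \<in> surviving_words L n" using assms by (auto simp: surviving_words_Suc_Cons n)
  with wy show "menger_map t x \<in> (\<Union>w\<in>surviving_words L n. menger_word_map w ` cbox 0 1)"
    by (intro UN_I[of "t # w"]) auto
qed

text \<open>Under \<open>proj\<close> the map \<open>menger_map t\<close> becomes \<open>?g\<close>,
  an affine map of slope 1/3, which keeps intervals nondegenerate. Iterated, this carries an
  interval found in any surviving subtree back to the root.\<close>

lemma contains_interval_descendant:
  assumes "t \<in> menger_digits" "L [t]"
    and "contains_interval (proj (a, b, c) ` menger_sponge (\<lambda>v. L (t # v)))"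
  shows "contains_interval (proj (a, b, c) ` menger_sponge L)"
proof -
  let ?g = "\<lambda>x. x / 3 + proj (a, b, c) t"
  from assms(3) obtain I x y where I: "is_interval I" "x \<in> I" "y \<in> I" "x \<noteq> y"
    "I \<subseteq> proj (a, b, c) ` menger_sponge (\<lambda>v. L (t # v))"
    unfolding contains_interval_def by blast
  have "is_interval (?g ` I)"
    using convex_affinity[of I "proj (a, b, c) t" "1/3"] I(1)
    by (simp add: is_interval_convex_1 add.commute)
  moreover have "?g x \<in> ?g ` I" "?g y \<in> ?g ` I" "?g x \<noteq> ?g y" using I by auto
  moreover have "?g ` I \<subseteq> proj (a, b, c) ` menger_sponge L"
  proof
    fix z assume "z \<in> ?g ` I"
    then obtain v where v: "v \<in> menger_sponge (\<lambda>v. L (t # v))" "z = ?g (proj (a, b, c) v)"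
      using I(5) by blast
    have "z = proj (a, b, c) (menger_map t v)"
      using v(2) by (simp add: menger_map_def proj_def field_simps)
    then show "z \<in> proj (a, b, c) ` menger_sponge L"
      using menger_map_menger_sponge[of t L v] assms v by blast
  qed
  ultimately show ?thesis unfolding contains_interval_def by metis
qed

text \<open>\<open>hit w x\<close> says that the copy under the word \<open>w\<close> of the window of radius \<open>\<rho>\<close> about the centre \<open>\<mu>\<close>
  contains \<open>x\<close>. The window is in general shorter than the projected cube, whose ends may be covered
  only once.\<close>

locale covered_projection =
  fixes a b c \<rho> :: real
  assumes rho_pos: "0 < \<rho>" and rho_le: "2 * \<rho> \<le> \<bar>a\<bar> + \<bar>b\<bar> + \<bar>c\<bar>"
    and cover: "\<And>z. \<bar>z\<bar> \<le> 3 * \<rho> \<Longrightarrow> 4 \<le> card (sign_cover a b c \<rho> z)"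
begin

definition \<mu> :: real where "\<mu> = (a + b + c) / 2"

definition hit :: "(real^3) list \<Rightarrow> real \<Rightarrow> bool" where
  "hit w x \<longleftrightarrow> \<bar>3 ^ length w * (x - proj (a, b, c) (menger_word_map w 0)) - \<mu>\<bar> \<le> \<rho>"

lemma hit_Nil: "hit [] x \<longleftrightarrow> \<bar>x - \<mu>\<bar> \<le> \<rho>"
  by (simp add: hit_def proj_def)

lemma hit_snoc:
  "hit (w @ [t]) x \<longleftrightarrow>
    \<bar>3 * (3 ^ length w * (x - proj (a, b, c) (menger_word_map w 0)) - proj (a, b, c) t) - \<mu>\<bar> \<le> \<rho>"
proof -
  have "menger_word_map (w @ [t]) 0 = (1/3) ^ length w *\<^sub>R t + menger_word_map w 0"
    using menger_word_map_affine[of w t] by (simp add: menger_word_map_append menger_map_def)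
  then have "proj (a, b, c) (menger_word_map (w @ [t]) 0) =
      (1/3) ^ length w * proj (a, b, c) t + proj (a, b, c) (menger_word_map w 0)"
    by (simp add: linear_add[OF proj_linear] linear_cmul[OF proj_linear])
  then show ?thesis by (simp add: hit_def algebra_simps power_one_over)
qed

text \<open>The coordinate \<open>y\<close> blows the copy under \<open>w\<close> up to unit size.
  For the digit \<open>t\<close> of a sign vector, \<open>3 * proj (a, b, c) t\<close> is
  \<open>2 * \<mu>\<close> plus the centre of that vector, so the child is hit iff
  \<open>3 * (y - \<mu>)\<close> is within \<open>\<rho>\<close> of the centre. Then
  \<open>cover\<close> applies.\<close>

lemma card_hit_children:
  assumes "hit w x"
  shows "4 \<le> card {t \<in> menger_digits. hit (w @ [t]) x}"
proof -
  define y where "y = 3 ^ length w * (x - proj (a, b, c) (menger_word_map w 0))"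
  have "\<bar>3 * (y - \<mu>)\<bar> \<le> 3 * \<rho>" using assms by (simp add: hit_def y_def)
  from cover[OF this] have "4 \<le> card (sign_cover a b c \<rho> (3 * (y - \<mu>)))" .
  also have "\<dots> \<le> card {t \<in> menger_digits. hit (w @ [t]) x}"
  proof (rule card_inj_on_le[of sign_digit])
    show "inj_on sign_digit (sign_cover a b c \<rho> (3 * (y - \<mu>)))"
      using inj_sign_digit by (rule inj_on_subset) simp
    show "finite {t \<in> menger_digits. hit (w @ [t]) x}" using finite_menger_digits by simp
    show "sign_digit ` sign_cover a b c \<rho> (3 * (y - \<mu>)) \<subseteq> {t \<in> menger_digits. hit (w @ [t]) x}"
    proof (safe intro!: image_subsetI)
      fix i j k assume e: "(i, j, k) \<in> sign_cover a b c \<rho> (3 * (y - \<mu>))"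
      then show "sign_digit (i, j, k) \<in> menger_digits"
        by (intro sign_digit_mem) (simp add: sign_cover_def)
      show "hit (w @ [sign_digit (i, j, k)]) x"
        using e proj_sign_digit[of a b c i j k] unfolding hit_snoc y_def[symmetric]
        by (simp add: sign_cover_def \<mu>_def right_diff_distrib diff_divide_distrib add_divide_distrib algebra_simps)
    qed
  qed
  finally show ?thesis .
qed

lemma card_menger_digits_ge: "4 \<le> card menger_digits"
  using card_hit_children[of "[]" \<mu>] rho_pos
    card_mono[OF finite_menger_digits, of "{t \<in> menger_digits. hit ([] @ [t]) \<mu>}"]
  by (simp add: hit_Nil)

lemma hit_imp_mem:
  assumes "hit w x"
  shows "x \<in> proj (a, b, c) ` menger_word_map w ` cbox 0 1"
proof -
  define S where "S = \<bar>a\<bar> + \<bar>b\<bar> + \<bar>c\<bar>"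
  define y where "y = 3 ^ length w * (x - proj (a, b, c) (menger_word_map w 0))"
  define \<theta> where "\<theta> = (y - \<mu>) / S"
  have S: "S > 0" using rho_pos rho_le by (simp add: S_def)
  have "\<bar>y - \<mu>\<bar> \<le> S / 2" using assms rho_le by (simp add: hit_def y_def S_def)
  then have \<theta>: "\<bar>\<theta>\<bar> \<le> 1 / 2" using S by (simp add: \<theta>_def field_simps)
  \<comment> \<open>Moving from the centre of the cube by \<open>\<theta>\<close> along the signs of
    \<open>a\<close>, \<open>b\<close>, \<open>c\<close> changes the projection by
    \<open>S * \<theta>\<close>. The bound \<open>rho_le\<close> gives
    \<open>\<bar>\<theta>\<bar> \<le> 1 / 2\<close>, which keeps \<open>v\<close> in the
    cube.\<close>
  define v :: "real^3" where "v = vector [1/2 + sgn a * \<theta>, 1/2 + sgn b * \<theta>, 1/2 + sgn c * \<theta>]"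
  have "\<bar>sgn r * \<theta>\<bar> \<le> 1/2" for r :: real using \<theta> by (auto simp: sgn_if)
  then have "0 \<le> 1/2 + sgn r * \<theta> \<and> 1/2 + sgn r * \<theta> \<le> 1" for r :: real by (smt (verit) field_sum_of_halves)
  then have "v \<in> cbox 0 1" by (auto simp: v_def mem_box_cart forall_3)
  moreover have "proj (a, b, c) v = \<mu> + S * \<theta>"
  proof -
    have "r * (1/2 + sgn r * \<theta>) = r / 2 + \<bar>r\<bar> * \<theta>" for r :: real
      by (auto simp: sgn_if algebra_simps)
    then have "proj (a, b, c) v = (a / 2 + \<bar>a\<bar> * \<theta>) + (b / 2 + \<bar>b\<bar> * \<theta>) + (c / 2 + \<bar>c\<bar> * \<theta>)"
      by (simp only: proj_def v_def vector_3 prod.case)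
    then show ?thesis by (simp add: \<mu>_def S_def distrib_right add_divide_distrib)
  qed
  then have "proj (a, b, c) v = y" using S by (simp add: \<theta>_def)
  then have "x = proj (a, b, c) (menger_word_map w v)"
    by (subst menger_word_map_affine)
       (simp add: y_def linear_add[OF proj_linear] linear_cmul[OF proj_linear] power_one_over)
  ultimately show ?thesis by blast
qed

text \<open>The words hit at different levels need not extend one another. Compactness repairs this:
  the fibres over \<open>x\<close> of the level-\<open>n\<close> approximations are nonempty,
  compact and decreasing, so they have a common point.\<close>

lemma mem_proj_menger_sponge:
  assumes "\<And>n. \<exists>w\<in>surviving_words L n. hit w x"
  shows "x \<in> proj (a, b, c) ` menger_sponge L"
proof -
  define K where "K n = (\<Union>w\<in>surviving_words L n. menger_word_map w ` cbox 0 1) \<inter> {v. proj (a, b, c) v = x}" for n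
  have cont: "continuous_on UNIV (proj (a, b, c))"
    using linear_continuous_on[OF proj_linear[THEN linear_conv_bounded_linear[THEN iffD1]]] .
  have compact: "compact (K n)" for n
    unfolding K_def
  proof (intro compact_Int_closed compact_UN finite_surviving_words compact_continuous_image compact_cbox)
    show "continuous_on (cbox 0 1) (menger_word_map w)" for w
      by (subst menger_word_map_affine[abs_def]) (intro continuous_intros)
    show "closed {v. proj (a, b, c) v = x}"
      by (intro closed_Collect_eq cont continuous_intros)
  qed
  have nonempty: "K n \<noteq> {}" for n
  proof -
    from assms obtain w where w: "w \<in> surviving_words L n" "hit w x" by blast
    from hit_imp_mem[OF w(2)] w(1) show ?thesis unfolding K_def by blast
  qed
  have nested: "K n \<subseteq> K m" if "m \<le> n" for m n
  proof
    fix v assume v: "v \<in> K n"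
    then obtain w u where w: "w \<in> surviving_words L n" "u \<in> cbox 0 1" "v = menger_word_map w u"
      unfolding K_def by blast
    have "menger_word_map (drop m w) u \<in> cbox 0 1"
      using w by (intro menger_word_map_cbox) (auto simp: surviving_words_def dest: in_set_dropD)
    moreover have "v = menger_word_map (take m w) (menger_word_map (drop m w) u)"
      using w(3) menger_word_map_append[of "take m w" "drop m w"] by simp
    ultimately show "v \<in> K m"
      using surviving_words_take[OF w(1) that] v unfolding K_def by blast
  qed
  have "\<Inter> (range K) \<noteq> {}"
    by (rule compact_nest[OF compact nonempty nested])
  then show ?thesis unfolding K_def menger_sponge_def by blast
qed

end

section \<open>Independent labels\<close>

text \<open>Stands in for measurability with respect to the coordinates in \<open>K\<close>, as a
  plain statement about functions. For finite \<open>K\<close> it yields measurability by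
  \<open>measurable_label_pred\<close>; for infinite \<open>K\<close> measurability is assumed
  alongside.\<close>

definition determined_by :: "'i set \<Rightarrow> (('i \<Rightarrow> 'b) \<Rightarrow> bool) \<Rightarrow> bool" where
  "determined_by K E \<longleftrightarrow> (\<forall>L L'. (\<forall>w\<in>K. L w = L' w) \<longrightarrow> E L = E L')"

lemma determined_by_mono: "determined_by K E \<Longrightarrow> K \<subseteq> K' \<Longrightarrow> determined_by K' E"
  unfolding determined_by_def by blast

text \<open>The canonical space on which all estimates are made;
  \<open>distr_bernoulli_labelling\<close> carries the result over to arbitrary labels.\<close>

definition label_measure :: "'i set \<Rightarrow> real \<Rightarrow> ('i \<Rightarrow> bool) measure" where
  "label_measure W p = (\<Pi>\<^sub>M w\<in>W. measure_pmf (bernoulli_pmf p))"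

lemma prob_space_label_measure: "prob_space (label_measure W p)"
  unfolding label_measure_def by (intro prob_space_PiM measure_pmf.prob_space_axioms)

lemma space_label_measure: "space (label_measure W p) = W \<rightarrow>\<^sub>E UNIV"
  by (simp add: label_measure_def space_PiM)

lemma sets_label_measure: "sets (label_measure W p) = sets (\<Pi>\<^sub>M w\<in>W. count_space UNIV)"
  unfolding label_measure_def by (intro sets_PiM_cong) auto

lemma measurable_label_restrict:
  "K \<subseteq> W \<Longrightarrow> (\<lambda>L. restrict L K) \<in> label_measure W p \<rightarrow>\<^sub>M label_measure K p"
  unfolding label_measure_def by (rule measurable_restrict_subset)

lemma measurable_label_pred:
  assumes "K \<subseteq> W" "finite K" "determined_by K E"
  shows "{L \<in> space (label_measure W p). E L} \<in> sets (label_measure W p)"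
proof -
  have "sets (label_measure K p) = Pow (K \<rightarrow>\<^sub>E UNIV)"
    unfolding sets_label_measure using assms(2) by (subst count_space_PiM_finite) auto
  then have "{L \<in> space (label_measure K p). E L} \<in> sets (label_measure K p)"
    by (auto simp: space_label_measure)
  from measurable_sets[OF measurable_label_restrict[OF assms(1)] this]
  have "(\<lambda>L. restrict L K) -` {L \<in> space (label_measure K p). E L} \<inter> space (label_measure W p)
    \<in> sets (label_measure W p)" .
  also have "(\<lambda>L. restrict L K) -` {L \<in> space (label_measure K p). E L} \<inter> space (label_measure W p) =
      {L \<in> space (label_measure W p). E L}"
    using assms(3)[unfolded determined_by_def, rule_format, of "restrict _ K"]
    by (auto simp: space_label_measure)
  finally show ?thesis .
qed

text \<open>A measurable way to extend labellings of \<open>K\<close> to \<open>W\<close>. Pulling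
  back along it shows that an event over \<open>W\<close> determined by \<open>K\<close> is
  measurable already over \<open>K\<close>.\<close>

lemma measurable_label_extend:
  "(\<lambda>L. \<lambda>w\<in>W. if w \<in> K then L w else False) \<in> label_measure K p \<rightarrow>\<^sub>M label_measure W p"
  unfolding label_measure_def
proof (rule measurable_restrict)
  fix w assume "w \<in> W"
  show "(\<lambda>L. if w \<in> K then L w else False)
      \<in> (\<Pi>\<^sub>M w\<in>K. measure_pmf (bernoulli_pmf p)) \<rightarrow>\<^sub>M measure_pmf (bernoulli_pmf p)"
    by (cases "w \<in> K") (auto intro: measurable_component_singleton)
qed

lemma indep_labels:
  "prob_space.indep_vars (label_measure W p) (\<lambda>_. measure_pmf (bernoulli_pmf p)) (\<lambda>w L. L w) W"
proof (cases "W = {}")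
  case True
  interpret prob_space "label_measure W p" by (rule prob_space_label_measure)
  show ?thesis unfolding indep_vars_def indep_sets_def using True by simp
next
  case False
  interpret prob_space "label_measure W p" by (rule prob_space_label_measure)
  have id: "(\<lambda>w\<in>W. L w) = L" if "L \<in> space (label_measure W p)" for L
    using that by (auto simp: space_label_measure)
  have comp: "distr (label_measure W p) (measure_pmf (bernoulli_pmf p)) (\<lambda>L. L w) = measure_pmf (bernoulli_pmf p)"
    if "w \<in> W" for w
    unfolding label_measure_def
    by (rule distr_PiM_component[of W "\<lambda>_. measure_pmf (bernoulli_pmf p)", OF _ that])
       (rule measure_pmf.prob_space_axioms)
  \<comment> \<open>On the product space restriction to \<open>W\<close> is the identity, so the
    joint law of the coordinates is the product measure itself.\<close>
  have "distr (label_measure W p) (\<Pi>\<^sub>M w\<in>W. measure_pmf (bernoulli_pmf p)) (\<lambda>L. \<lambda>w\<in>W. L w)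
      = distr (label_measure W p) (label_measure W p) (\<lambda>L. L)"
    unfolding label_measure_def[symmetric] by (intro distr_cong refl id)
  also have "\<dots> = label_measure W p" by (rule distr_id)
  also have "\<dots> = (\<Pi>\<^sub>M w\<in>W. distr (label_measure W p) (measure_pmf (bernoulli_pmf p)) (\<lambda>L. L w))"
    unfolding label_measure_def using comp[unfolded label_measure_def] by (intro PiM_cong) auto
  finally show ?thesis
    using False by (subst indep_vars_iff_distr_eq_PiM') 
       (auto simp: label_measure_def intro!: measurable_component_singleton)
qed

text \<open>Restrictions of a labelling to disjoint blocks are independent, and \<open>E j\<close>
  is the preimage of an event under restriction to \<open>K j\<close>. The blocks may be infinite,
  as whole subtrees are.\<close>

lemma prob_label_blocks:
  assumes J: "finite J" "J \<noteq> {}" "disjoint_family_on K J" "\<And>j. j \<in> J \<Longrightarrow> K j \<subseteq> W"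
    and det: "\<And>j. j \<in> J \<Longrightarrow> determined_by (K j) (E j)"
    and meas: "\<And>j. j \<in> J \<Longrightarrow> {L \<in> space (label_measure W p). E j L} \<in> sets (label_measure W p)"
  shows "measure (label_measure W p) {L \<in> space (label_measure W p). \<forall>j\<in>J. E j L} =
    (\<Prod>j\<in>J. measure (label_measure W p) {L \<in> space (label_measure W p). E j L})"
proof -
  interpret prob_space "label_measure W p" by (rule prob_space_label_measure)
  let ?A = "\<lambda>j. {L \<in> space (label_measure (K j) p). E j L}"
  have A: "?A j \<in> sets (label_measure (K j) p)" if j: "j \<in> J" for j
  proof -
    let ?f = "\<lambda>L. \<lambda>w\<in>W. if w \<in> K j then L w else False"
    have "E j (?f L) = E j L" for L
      by (rule det[OF j, unfolded determined_by_def, rule_format]) (use J(4)[OF j] in auto)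
    then have "?A j = ?f -` {L \<in> space (label_measure W p). E j L} \<inter> space (label_measure (K j) p)"
      by (auto simp: space_label_measure)
    also have "\<dots> \<in> sets (label_measure (K j) p)"
      by (rule measurable_sets[OF measurable_label_extend meas[OF j]])
    finally show ?thesis .
  qed
  have eq: "(\<lambda>L. restrict L (K j)) -` ?A j \<inter> space (label_measure W p) =
      {L \<in> space (label_measure W p). E j L}" if j: "j \<in> J" for j
    using det[OF j, unfolded determined_by_def, rule_format, of "restrict _ (K j)"]
    by (auto simp: space_label_measure)
  have "indep_vars (\<lambda>j. label_measure (K j) p) (\<lambda>j L. restrict L (K j)) J"
    unfolding label_measure_def[of "K _"]
    using indep_vars_restrict[OF indep_labels J(4,3)] by simp
  from indep_varsD_finite[OF this J(2,1) A]
  have "prob (\<Inter>j\<in>J. (\<lambda>L. restrict L (K j)) -` ?A j \<inter> space (label_measure W p)) =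
      (\<Prod>j\<in>J. prob ((\<lambda>L. restrict L (K j)) -` ?A j \<inter> space (label_measure W p)))" by simp
  also have "(\<Inter>j\<in>J. (\<lambda>L. restrict L (K j)) -` ?A j \<inter> space (label_measure W p)) =
      {L \<in> space (label_measure W p). \<forall>j\<in>J. E j L}"
    using J(2) eq by auto
  also have "(\<Prod>j\<in>J. prob ((\<lambda>L. restrict L (K j)) -` ?A j \<inter> space (label_measure W p))) =
      (\<Prod>j\<in>J. prob {L \<in> space (label_measure W p). E j L})"
    by (intro prod.cong refl arg_cong[where f = prob] eq)
  finally show ?thesis .
qed

lemma prob_label_conj:
  assumes "K \<inter> K' = {}" "K \<subseteq> W" "K' \<subseteq> W" "determined_by K E" "determined_by K' E'"
    and "{L \<in> space (label_measure W p). E L} \<in> sets (label_measure W p)"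
    and "{L \<in> space (label_measure W p). E' L} \<in> sets (label_measure W p)"
  shows "measure (label_measure W p) {L \<in> space (label_measure W p). E L \<and> E' L} =
    measure (label_measure W p) {L \<in> space (label_measure W p). E L} *
    measure (label_measure W p) {L \<in> space (label_measure W p). E' L}"
proof -
  have "measure (label_measure W p) {L \<in> space (label_measure W p). \<forall>j\<in>UNIV. case_bool E E' j L} =
    (\<Prod>j\<in>UNIV. measure (label_measure W p) {L \<in> space (label_measure W p). case_bool E E' j L})"
    using assms by (intro prob_label_blocks[where K = "case_bool K K'"])
      (auto simp: disjoint_family_on_def split: bool.splits)
  moreover have "(\<forall>j\<in>UNIV. case_bool E E' j L) \<longleftrightarrow> E L \<and> E' L" for L
    by (auto simp: UNIV_bool split: bool.splits)
  ultimately show ?thesis by (simp only:) (simp add: UNIV_bool mult.commute)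
qed

lemma prob_label:
  assumes "w \<in> W" "0 \<le> p" "p \<le> 1"
  shows "measure (label_measure W p) {L \<in> space (label_measure W p). L w} = p"
proof -
  have "measure_pmf (bernoulli_pmf p) = distr (label_measure W p) (measure_pmf (bernoulli_pmf p)) (\<lambda>L. L w)"
    unfolding label_measure_def
    by (rule distr_PiM_component[of W "\<lambda>_. measure_pmf (bernoulli_pmf p)", OF _ assms(1), symmetric])
       (rule measure_pmf.prob_space_axioms)
  then have "measure (measure_pmf (bernoulli_pmf p)) {True} =
      measure (distr (label_measure W p) (measure_pmf (bernoulli_pmf p)) (\<lambda>L. L w)) {True}" by simp
  also have "\<dots> = measure (label_measure W p) ((\<lambda>L. L w) -` {True} \<inter> space (label_measure W p))"
    using assms(1) by (intro measure_distr) (auto simp: label_measure_def intro: measurable_component_singleton)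
  also have "(\<lambda>L. L w) -` {True} \<inter> space (label_measure W p) = {L \<in> space (label_measure W p). L w}"
    by auto
  finally show ?thesis using assms by (simp add: measure_pmf_single)
qed

lemma prob_all_labels:
  assumes "finite K" "K \<subseteq> W" "0 \<le> p" "p \<le> 1"
  shows "measure (label_measure W p) {L \<in> space (label_measure W p). \<forall>w\<in>K. L w} = p ^ card K"
proof (cases "K = {}")
  case True
  then show ?thesis using prob_space.prob_space[OF prob_space_label_measure] by simp
next
  case False
  have "measure (label_measure W p) {L \<in> space (label_measure W p). \<forall>w\<in>K. L w} =
      (\<Prod>w\<in>K. measure (label_measure W p) {L \<in> space (label_measure W p). L w})"
    using False assms
    by (intro prob_label_blocks[where K = "\<lambda>w. {w}"] measurable_label_pred[of "{_}"])
       (auto simp: disjoint_family_on_def determined_by_def)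
  also have "\<dots> = p ^ card K" using assms by (simp add: prob_label subset_iff)
  finally show ?thesis .
qed

text \<open>Hoeffding's inequality for \<open>card U\<close> independent variables with values in
  [0, 1] and a deviation of \<open>\<epsilon> * card U\<close> below the mean
  \<open>p * card U\<close>.\<close>

lemma prob_few_labels:
  assumes U: "finite U" "U \<noteq> {}" "U \<subseteq> W" and p: "0 \<le> p" "p \<le> 1" and "0 \<le> \<epsilon>"
  shows "measure (label_measure W p)
      {L \<in> space (label_measure W p). real (card {v \<in> U. L v}) \<le> (p - \<epsilon>) * real (card U)}
    \<le> exp (- (2 * \<epsilon>\<^sup>2 * real (card U)))"
proof -
  interpret prob_space "label_measure W p" by (rule prob_space_label_measure)
  have meas: "(\<lambda>L. L v) \<in> label_measure W p \<rightarrow>\<^sub>M measure_pmf (bernoulli_pmf p)" if "v \<in> U" for v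
    using that U unfolding label_measure_def by (intro measurable_component_singleton) auto
  interpret Hoeffding_ineq "label_measure W p" U "\<lambda>v L. of_bool (L v)" "\<lambda>_. 0" "\<lambda>_. 1"
      "\<Sum>v\<in>U. expectation (\<lambda>L. of_bool (L v))"
  proof unfold_locales
    show "indep_vars (\<lambda>_. borel) (\<lambda>v L. of_bool (L v) :: real) U"
      by (rule indep_vars_compose2[OF indep_vars_subset[OF indep_labels U(3)]]) simp
  qed (use U in auto)
  have "expectation (\<lambda>L. of_bool (L v)) = p" if "v \<in> U" for v
  proof -
    have "expectation (\<lambda>L. of_bool (L v)) = expectation (indicator {L \<in> space (label_measure W p). L v})"
      by (intro Bochner_Integration.integral_cong) (auto simp: indicator_def)
    also have "\<dots> = prob ({L \<in> space (label_measure W p). L v} \<inter> space (label_measure W p))" by simp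
    also have "{L \<in> space (label_measure W p). L v} \<inter> space (label_measure W p) =
        {L \<in> space (label_measure W p). L v}" by auto
    also have "prob \<dots> = p" using prob_label[of v W p] that U p by auto
    finally show ?thesis .
  qed
  then have mean: "(\<Sum>v\<in>U. expectation (\<lambda>L. of_bool (L v))) = p * real (card U)" by simp
  have "card U > 0" using U by (simp add: card_gt_0_iff)
  then have "prob {L \<in> space (label_measure W p). (\<Sum>v\<in>U. of_bool (L v)) \<le> p * real (card U) - \<epsilon> * real (card U)}
      \<le> exp (- 2 * (\<epsilon> * real (card U))\<^sup>2 / real (card U))"
    using Hoeffding_ineq_le[of "\<epsilon> * real (card U)"] assms(6) mean by simp
  also have "- 2 * (\<epsilon> * real (card U))\<^sup>2 / real (card U) = - (2 * \<epsilon>\<^sup>2 * real (card U))"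
    using \<open>card U > 0\<close> by (simp add: power2_eq_square)
  also have "{L \<in> space (label_measure W p). (\<Sum>v\<in>U. of_bool (L v)) \<le> p * real (card U) - \<epsilon> * real (card U)} =
      {L \<in> space (label_measure W p). real (card {v \<in> U. L v}) \<le> (p - \<epsilon>) * real (card U)}"
  proof -
    have "(\<Sum>v\<in>U. of_bool (L v)) = real (card {v \<in> U. L v})" for L
      using U(1) by (simp add: Int_def flip: sum.inter_filter)
    then show ?thesis by (simp add: left_diff_distrib)
  qed
  finally show ?thesis .
qed

text \<open>An injective relabelling preserves a product of identical factors. With
  \<open>f = (#) t\<close> this says that the subtree below \<open>t\<close> has the law of the
  whole tree.\<close>

lemma label_measure_reindex:
  assumes "inj_on f W" "f ` W \<subseteq> W"
    and "determined_by W E" "{L \<in> space (label_measure W p). E L} \<in> sets (label_measure W p)"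
  shows measurable_label_reindex:
      "{L \<in> space (label_measure W p). E (\<lambda>w. L (f w))} \<in> sets (label_measure W p)" (is ?A)
    and prob_label_reindex: "measure (label_measure W p) {L \<in> space (label_measure W p). E (\<lambda>w. L (f w))} =
      measure (label_measure W p) {L \<in> space (label_measure W p). E L}" (is ?B)
proof -
  let ?f = "\<lambda>L. \<lambda>w\<in>W. L (f w)"
  have f: "?f \<in> label_measure W p \<rightarrow>\<^sub>M label_measure W p"
    unfolding label_measure_def using assms(2) by (intro measurable_restrict measurable_component_singleton) auto
  have "E (?f L) = E (\<lambda>w. L (f w))" for L
    using assms(3)[unfolded determined_by_def, rule_format, of "?f L" "\<lambda>w. L (f w)"] by auto
  then have eq: "?f -` {L \<in> space (label_measure W p). E L} \<inter> space (label_measure W p) =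
      {L \<in> space (label_measure W p). E (\<lambda>w. L (f w))}"
    by (auto simp: space_label_measure)
  from measurable_sets[OF f assms(4)] show ?A unfolding eq .
  have "distr (label_measure W p) (label_measure W p) ?f = label_measure W p"
    unfolding label_measure_def
    using distr_PiM_reindex[of W "\<lambda>_. measure_pmf (bernoulli_pmf p)" f W] assms(1,2)
    by (auto simp: measure_pmf.prob_space_axioms)
  then have "measure (label_measure W p) {L \<in> space (label_measure W p). E L} =
      measure (distr (label_measure W p) (label_measure W p) ?f) {L \<in> space (label_measure W p). E L}" by simp
  also have "\<dots> = measure (label_measure W p) {L \<in> space (label_measure W p). E (\<lambda>w. L (f w))}"
    unfolding measure_distr[OF f assms(4)] eq ..
  finally show ?B by simp
qed

section \<open>Growth of the coverage\<close>

text \<open>As a set of words hit by a point is determined by its position among the window ends, a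
  union bound over the uncountably many points of the window is really a finite one.\<close>

lemma card_interval_patterns:
  fixes l r :: "'i \<Rightarrow> real"
  assumes "finite V"
  defines "F \<equiv> range (\<lambda>x. {v \<in> V. l v \<le> x \<and> x \<le> r v})"
  shows "finite F \<and> card F \<le> (card V + 1)\<^sup>2"
proof -
  \<comment> \<open>Patterns cut out by half-lines form a chain, and a chain of subsets of
    \<open>V\<close> has at most \<open>card V + 1\<close> members, since cardinality is injective
    on it. An interval pattern is the intersection of a member of each chain, whence the
    square.\<close>
  define A where "A = range (\<lambda>x. {v \<in> V. l v \<le> x})"
  define B where "B = range (\<lambda>x. {v \<in> V. x \<le> r v})"
  have chain: "card C \<le> card V + 1" if "C \<subseteq> Pow V" "\<And>S T. S \<in> C \<Longrightarrow> T \<in> C \<Longrightarrow> S \<subseteq> T \<or> T \<subseteq> S" for C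
  proof -
    have "inj_on card C"
      using that assms(1) by (intro inj_onI) (metis Pow_iff card_subset_eq finite_subset subsetD)
    moreover have "card ` C \<subseteq> {..card V}"
      using that(1) assms(1) by (auto intro: card_mono)
    ultimately show ?thesis using card_inj_on_le[of card C "{..card V}"] by simp
  qed
  have "card A \<le> card V + 1" unfolding A_def
  proof (rule chain)
    fix S T assume "S \<in> range (\<lambda>x. {v \<in> V. l v \<le> x})" "T \<in> range (\<lambda>x. {v \<in> V. l v \<le> x})"
    then obtain x y where "S = {v \<in> V. l v \<le> x}" "T = {v \<in> V. l v \<le> y}" by auto
    then show "S \<subseteq> T \<or> T \<subseteq> S" by (cases "x \<le> y") auto
  qed auto
  moreover have "card B \<le> card V + 1" unfolding B_def
  proof (rule chain)
    fix S T assume "S \<in> range (\<lambda>x. {v \<in> V. x \<le> r v})" "T \<in> range (\<lambda>x. {v \<in> V. x \<le> r v})"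
    then obtain x y where "S = {v \<in> V. x \<le> r v}" "T = {v \<in> V. y \<le> r v}" by auto
    then show "S \<subseteq> T \<or> T \<subseteq> S" by (cases "x \<le> y") auto
  qed auto
  moreover have fin: "finite A" "finite B"
    using assms(1) by (auto simp: A_def B_def intro: finite_subset[of _ "Pow V"])
  moreover have F: "F \<subseteq> (\<lambda>(S, T). S \<inter> T) ` (A \<times> B)"
  proof
    fix S assume "S \<in> F"
    then obtain x where "S = {v \<in> V. l v \<le> x \<and> x \<le> r v}" by (auto simp: F_def)
    then have "S = (\<lambda>(S, T). S \<inter> T) ({v \<in> V. l v \<le> x}, {v \<in> V. x \<le> r v})" by auto
    moreover have "({v \<in> V. l v \<le> x}, {v \<in> V. x \<le> r v}) \<in> A \<times> B"
      unfolding A_def B_def by blast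
    ultimately show "S \<in> (\<lambda>(S, T). S \<inter> T) ` (A \<times> B)" by (rule image_eqI)
  qed
  then have "card F \<le> card (A \<times> B)"
    using fin by (meson card_image_le card_mono finite_SigmaI finite_imageI order_trans)
  moreover have "card (A \<times> B) = card A * card B" by (rule card_cartesian_product)
  ultimately have "card F \<le> (card V + 1) * (card V + 1)"
    by (metis mult_le_mono order_trans)
  moreover have "finite F" using F fin by (meson finite_SigmaI finite_imageI finite_subset)
  ultimately show ?thesis by (simp add: power2_eq_square)
qed

section \<open>Words of a given level and the labels that decide them\<close>

lemma card_words: "card (words n) = card menger_digits ^ n"
  unfolding words_def by (rule card_lists_length_eq[OF finite_menger_digits])

lemma words_subset_menger_words: "0 < n \<Longrightarrow> words n \<subseteq> menger_words"
  by (auto simp: words_def menger_words_def)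

text \<open>Separates the randomness: the survivors of level \<open>n\<close> fix the candidates of
  level \<open>Suc n\<close>, and the only new information is each candidate's own label.\<close>

lemma surviving_words_Suc_butlast:
  "surviving_words L (Suc n) = {v \<in> words (Suc n). butlast v \<in> surviving_words L n \<and> L v}"
proof (intro set_eqI iffI)
  fix v assume "v \<in> {v \<in> words (Suc n). butlast v \<in> surviving_words L n \<and> L v}"
  then show "v \<in> surviving_words L (Suc n)"
    by (cases v rule: rev_cases) (auto simp: surviving_words_Suc_snoc words_def)
next
  fix v assume v: "v \<in> surviving_words L (Suc n)"
  moreover from v have "v \<in> words (Suc n)" using surviving_words_subset by blast
  ultimately show "v \<in> {v \<in> words (Suc n). butlast v \<in> surviving_words L n \<and> L v}"
    by (auto simp: surviving_words_Suc_snoc)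
qed

text \<open>Lengths start at 1, as the empty word carries no label.\<close>

definition short_words :: "nat \<Rightarrow> (real^3) list set" where
  "short_words n = (\<Union>k\<in>{1..n}. words k)"

lemma finite_short_words: "finite (short_words n)"
  by (simp add: short_words_def finite_words)

lemma short_words_subset: "short_words n \<subseteq> menger_words"
  unfolding short_words_def by (intro UN_least words_subset_menger_words) simp

lemma short_words_mono: "m \<le> n \<Longrightarrow> short_words m \<subseteq> short_words n"
  unfolding short_words_def by (intro UN_mono) auto

lemma surviving_words_cong:
  assumes "\<And>w. w \<in> short_words n \<Longrightarrow> L w = L' w"
  shows "surviving_words L n = surviving_words L' n"
proof -
  have "L (take k w) = L' (take k w)" if "set w \<subseteq> menger_digits" "length w = n" "k \<in> {1..n}" for w k
    using that by (intro assms) (auto simp: short_words_def words_def dest: in_set_takeD)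
  then show ?thesis unfolding surviving_words_def by blast
qed

lemma determined_by_surviving_words:
  assumes "m \<le> n" shows "determined_by (short_words n) (\<lambda>L. Q (surviving_words L m))"
  unfolding determined_by_def
  using surviving_words_cong[of m] short_words_mono[OF assms] by (metis subsetD)

lemma measurable_surviving_words:
  "{L \<in> space (label_measure menger_words p). Q (surviving_words L n)} \<in> sets (label_measure menger_words p)"
  by (rule measurable_label_pred[OF short_words_subset finite_short_words determined_by_surviving_words[OF order_refl]])

lemma surviving_words_all:
  assumes "\<And>w. w \<in> short_words n \<Longrightarrow> L w" "k \<le> n"
  shows "surviving_words L k = words k"
proof -
  have "L (take j w)" if "set w \<subseteq> menger_digits" "length w = k" "j \<in> {1..k}" for w j
    using that assms(2) by (intro assms(1)) (auto simp: short_words_def words_def dest: in_set_takeD)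
  then show ?thesis unfolding surviving_words_def words_def by blast
qed

context covered_projection
begin

text \<open>For a word of length \<open>n\<close>, being hit by \<open>x\<close> means that
  \<open>x\<close> lies in a closed interval of length \<open>2 * \<rho> / 3 ^ n\<close>, so the
  count of interval patterns applies.\<close>

lemma hit_patterns:
  "finite (range (\<lambda>x. {v \<in> words n. hit v x}))"
  "card (range (\<lambda>x. {v \<in> words n. hit v x})) \<le> (card menger_digits ^ n + 1)\<^sup>2"
proof -
  define q where "q v = proj (a, b, c) (menger_word_map v 0)" for v
  have "hit v x \<longleftrightarrow> q v + (\<mu> - \<rho>) / 3 ^ n \<le> x \<and> x \<le> q v + (\<mu> + \<rho>) / 3 ^ n" if "v \<in> words n" for v x
  proof -
    have "hit v x \<longleftrightarrow> \<mu> - \<rho> \<le> 3 ^ n * (x - q v) \<and> 3 ^ n * (x - q v) \<le> \<mu> + \<rho>"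
      using that by (auto simp: hit_def q_def words_def abs_le_iff)
    also have "\<dots> \<longleftrightarrow> (\<mu> - \<rho>) / 3 ^ n \<le> x - q v \<and> x - q v \<le> (\<mu> + \<rho>) / 3 ^ n"
      by (simp add: pos_divide_le_eq pos_le_divide_eq mult.commute)
    finally show ?thesis by (auto simp: algebra_simps)
  qed
  then have eq: "{v \<in> words n. hit v x} =
      {v \<in> words n. q v + (\<mu> - \<rho>) / 3 ^ n \<le> x \<and> x \<le> q v + (\<mu> + \<rho>) / 3 ^ n}" for x
    by blast
  show "finite (range (\<lambda>x. {v \<in> words n. hit v x}))"
    "card (range (\<lambda>x. {v \<in> words n. hit v x})) \<le> (card menger_digits ^ n + 1)\<^sup>2"
    using card_interval_patterns[OF finite_words[of n], of "\<lambda>v. q v + (\<mu> - \<rho>) / 3 ^ n" "\<lambda>v. q v + (\<mu> + \<rho>) / 3 ^ n"]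
    unfolding eq card_words by auto
qed

text \<open>Counts candidates before their labels are read. The factor 4 is the source of the
  threshold 1/4 for \<open>p\<close>.\<close>

lemma card_hit_Suc:
  assumes "S \<subseteq> words n"
  shows "4 * card {w \<in> S. hit w x} \<le> card {v \<in> words (Suc n). hit v x \<and> butlast v \<in> S}"
proof -
  let ?A = "SIGMA w:{w \<in> S. hit w x}. {t \<in> menger_digits. hit (w @ [t]) x}"
  have fin: "finite {w \<in> S. hit w x}" using finite_subset[OF assms finite_words] by simp
  have "4 * card {w \<in> S. hit w x} = (\<Sum>w\<in>{w \<in> S. hit w x}. 4)" by simp
  also have "\<dots> \<le> (\<Sum>w\<in>{w \<in> S. hit w x}. card {t \<in> menger_digits. hit (w @ [t]) x})"
    by (rule sum_mono) (simp add: card_hit_children)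
  also have "\<dots> = card ?A"
    using fin finite_menger_digits by (intro card_SigmaI[symmetric]) auto
  also have "\<dots> \<le> card {v \<in> words (Suc n). hit v x \<and> butlast v \<in> S}"
  proof (rule card_inj_on_le[of "\<lambda>(w, t). w @ [t]"])
    show "finite {v \<in> words (Suc n). hit v x \<and> butlast v \<in> S}" using finite_words by simp
    show "(\<lambda>(w, t). w @ [t]) ` ?A \<subseteq> {v \<in> words (Suc n). hit v x \<and> butlast v \<in> S}"
      using assms by (force simp: words_def)
  qed (auto intro: inj_onI)
  finally show ?thesis .
qed

section \<open>Persistence of exponentially large coverage\<close>

definition rich :: "real \<Rightarrow> nat \<Rightarrow> (real^3) list set \<Rightarrow> bool" where
  "rich lam n S \<longleftrightarrow> (\<forall>x. \<bar>x - \<mu>\<bar> \<le> \<rho> \<longrightarrow> lam ^ n \<le> real (card {w \<in> S. hit w x}))"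

text \<open>Including all earlier levels makes these events decrease in \<open>n\<close>, which the
  limit argument in \<open>prob_rich_pos\<close> exploits.\<close>

definition rich_upto :: "real \<Rightarrow> nat \<Rightarrow> ((real^3) list \<Rightarrow> bool) \<Rightarrow> bool" where
  "rich_upto lam n L \<longleftrightarrow> (\<forall>k\<le>n. rich lam k (surviving_words L k))"

text \<open>Supplies the start of the growth, on the event that all labels up to some level are 1;
  \<open>card_hit_Suc\<close> then gives at least \<open>4 ^ n\<close> hits.\<close>

lemma rich_words:
  assumes "0 \<le> lam" "lam \<le> 4"
  shows "rich lam n (words n)"
proof -
  have "4 ^ n \<le> card {w \<in> words n. hit w x}" if x: "\<bar>x - \<mu>\<bar> \<le> \<rho>" for x
  proof (induction n)
    case 0
    have "{w \<in> words 0. hit w x} = {[]}" using x by (auto simp: words_def hit_Nil)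
    then show ?case by simp
  next
    case (Suc n)
    have "4 ^ Suc n \<le> 4 * card {w \<in> words n. hit w x}" using Suc by simp
    also have "\<dots> \<le> card {v \<in> words (Suc n). hit v x \<and> butlast v \<in> words n}"
      by (rule card_hit_Suc) simp
    also have "\<dots> \<le> card {v \<in> words (Suc n). hit v x}"
      by (intro card_mono) (auto simp: finite_words)
    finally show ?case .
  qed
  moreover have "lam ^ n \<le> real (4 ^ n)" using power_mono[OF assms(2,1)] by simp
  ultimately show ?thesis unfolding rich_def by (meson of_nat_mono order_trans)
qed

lemma determined_by_rich_upto: "determined_by (short_words n) (rich_upto lam n)"
proof -
  have "determined_by (short_words n) (\<lambda>L. rich lam k (surviving_words L k))" if "k \<le> n" for k
    using determined_by_surviving_words[OF that] .
  then show ?thesis unfolding determined_by_def rich_upto_def by blast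
qed

lemma measurable_rich_upto:
  "{L \<in> space (label_measure menger_words p). rich_upto lam n L} \<in> sets (label_measure menger_words p)"
  by (rule measurable_label_pred[OF short_words_subset finite_short_words determined_by_rich_upto])

text \<open>\<open>V\<close> stands for the set of words of length \<open>Suc n\<close> that are hit by some point, and \<open>S\<close> for the
  set of words surviving up to level \<open>n\<close>. For fixed \<open>S\<close> and \<open>V\<close> the event depends on the labels of
  level \<open>Suc n\<close> only.\<close>

definition failure :: "real \<Rightarrow> nat \<Rightarrow> (real^3) list set \<Rightarrow> (real^3) list set \<Rightarrow> ((real^3) list \<Rightarrow> bool) \<Rightarrow> bool" where
  "failure lam n S V L \<longleftrightarrow> 4 * lam ^ n \<le> real (card {v \<in> V. butlast v \<in> S}) \<and>
     real (card {v \<in> {v \<in> V. butlast v \<in> S}. L v}) \<le> lam ^ Suc n"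

lemma failure_if_not_rich:
  assumes "rich lam n (surviving_words L n)" "\<not> rich lam (Suc n) (surviving_words L (Suc n))"
  shows "\<exists>V\<in>range (\<lambda>x. {v \<in> words (Suc n). hit v x}). failure lam n (surviving_words L n) V L"
proof -
  let ?S = "surviving_words L n"
  obtain x where x: "\<bar>x - \<mu>\<bar> \<le> \<rho>" "real (card {w \<in> surviving_words L (Suc n). hit w x}) < lam ^ Suc n"
    using assms(2) by (auto simp: rich_def not_le)
  let ?V = "{v \<in> words (Suc n). hit v x}"
  have V: "{v \<in> words (Suc n). hit v x \<and> butlast v \<in> ?S} = {v \<in> ?V. butlast v \<in> ?S}"
    "{v \<in> {v \<in> ?V. butlast v \<in> ?S}. L v} = {w \<in> surviving_words L (Suc n). hit w x}"
    by (auto simp: surviving_words_Suc_butlast)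
  have "lam ^ n \<le> real (card {w \<in> ?S. hit w x})" using assms(1) x(1) by (simp add: rich_def)
  moreover have "real (4 * card {w \<in> ?S. hit w x}) \<le> real (card {v \<in> ?V. butlast v \<in> ?S})"
    unfolding V(1)[symmetric] by (intro of_nat_mono card_hit_Suc surviving_words_subset)
  ultimately have "4 * lam ^ n \<le> real (card {v \<in> ?V. butlast v \<in> ?S})" by linarith
  then have "failure lam n ?S ?V L"
    unfolding failure_def V(2) using x(2) by linarith
  then show ?thesis by (rule bexI[OF _ rangeI])
qed

lemma measurable_failure:
  assumes "V \<subseteq> words (Suc n)"
  shows "{L \<in> space (label_measure menger_words p). failure lam n S V L} \<in> sets (label_measure menger_words p)"
proof (rule measurable_label_pred[OF words_subset_menger_words finite_words])
  show "determined_by (words (Suc n)) (failure lam n S V)"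
    unfolding determined_by_def
  proof (intro allI impI)
    fix L L' :: "(real^3) list \<Rightarrow> bool" assume "\<forall>w\<in>words (Suc n). L w = L' w"
    then have "{v \<in> {v \<in> V. butlast v \<in> S}. L v} = {v \<in> {v \<in> V. butlast v \<in> S}. L' v}"
      using assms by blast
    then show "failure lam n S V L = failure lam n S V L'" unfolding failure_def by presburger
  qed
qed simp

text \<open>With at least \<open>4 * lam ^ n\<close> candidates, the identity
  \<open>lam ^ Suc n = (p - \<epsilon>) * (4 * lam ^ n)\<close> turns failure into a proportion of
  label 1 of at most \<open>p - \<epsilon>\<close>. Hoeffding's exponent is then at least
  \<open>2 * \<epsilon>\<^sup>2 * (4 * lam ^ n)\<close>.\<close>

lemma prob_failure:
  assumes "V \<subseteq> words (Suc n)" "0 < lam" "0 \<le> \<epsilon>" "lam = 4 * (p - \<epsilon>)" "p \<le> 1"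
  shows "measure (label_measure menger_words p) {L \<in> space (label_measure menger_words p). failure lam n S V L}
    \<le> exp (- (8 * \<epsilon>\<^sup>2 * lam ^ n))"
proof (cases "4 * lam ^ n \<le> real (card {v \<in> V. butlast v \<in> S})")
  case False
  then show ?thesis by (simp add: failure_def)
next
  case True
  interpret prob_space "label_measure menger_words p" by (rule prob_space_label_measure)
  let ?U = "{v \<in> V. butlast v \<in> S}"
  have fin: "finite ?U" using finite_subset[OF assms(1) finite_words] by simp
  have "card ?U \<noteq> 0" using True assms(2) zero_less_power[of lam n] by linarith
  then have nonempty: "?U \<noteq> {}" by force
  have sub: "?U \<subseteq> menger_words" using assms(1) words_subset_menger_words[of "Suc n"] by auto
  have "0 \<le> p" using assms by auto
  have few: "real (card {v \<in> ?U. L v}) \<le> (p - \<epsilon>) * real (card ?U)" if "failure lam n S V L" for L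
  proof -
    have "real (card {v \<in> ?U. L v}) \<le> lam ^ Suc n" using that by (simp add: failure_def)
    also have "\<dots> = (p - \<epsilon>) * (4 * lam ^ n)" using assms by simp
    also have "\<dots> \<le> (p - \<epsilon>) * real (card ?U)"
      using True assms by (intro mult_left_mono) auto
    finally show ?thesis .
  qed
  have "prob {L \<in> space (label_measure menger_words p). failure lam n S V L}
      \<le> prob {L \<in> space (label_measure menger_words p). real (card {v \<in> ?U. L v}) \<le> (p - \<epsilon>) * real (card ?U)}"
  proof (rule finite_measure_mono)
    show "{L \<in> space (label_measure menger_words p). real (card {v \<in> ?U. L v}) \<le> (p - \<epsilon>) * real (card ?U)}
        \<in> sets (label_measure menger_words p)"
    proof (rule measurable_label_pred[OF sub fin])
      show "determined_by ?U (\<lambda>L. real (card {v \<in> ?U. L v}) \<le> (p - \<epsilon>) * real (card ?U))"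
        unfolding determined_by_def
      proof (intro allI impI)
        fix L L' :: "(real^3) list \<Rightarrow> bool" assume "\<forall>w\<in>?U. L w = L' w"
        then have "{v \<in> ?U. L v} = {v \<in> ?U. L' v}" by blast
        then show "(real (card {v \<in> ?U. L v}) \<le> (p - \<epsilon>) * real (card ?U)) =
          (real (card {v \<in> ?U. L' v}) \<le> (p - \<epsilon>) * real (card ?U))" by presburger
      qed
    qed
  qed (use few in blast)
  also have "\<dots> \<le> exp (- (2 * \<epsilon>\<^sup>2 * real (card ?U)))"
    by (rule prob_few_labels[OF fin nonempty sub \<open>0 \<le> p\<close> assms(5,3)])
  also have "\<dots> \<le> exp (- (8 * \<epsilon>\<^sup>2 * lam ^ n))"
    using mult_left_mono[OF True, of "2 * \<epsilon>\<^sup>2"] by simp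
  finally show ?thesis .
qed

text \<open>A union bound: the number of patterns of level \<open>Suc n\<close> from
  \<open>hit_patterns\<close> times the estimate of \<open>prob_failure\<close>.\<close>

definition fail_bound :: "real \<Rightarrow> real \<Rightarrow> nat \<Rightarrow> real" where
  "fail_bound lam \<epsilon> n = (real (card menger_digits) ^ Suc n + 1)\<^sup>2 * exp (- (8 * \<epsilon>\<^sup>2 * lam ^ n))"

text \<open>Conditioning on the set \<open>S\<close> of survivors of level \<open>n\<close>:
  \<open>?G S\<close> depends on labels of length up to \<open>n\<close> and \<open>?F S\<close> on
  labels of length \<open>Suc n\<close>, so they are independent. The events \<open>?G S\<close>
  partition \<open>rich_upto lam n\<close>, and summing over \<open>S\<close> loses at most the
  proportion \<open>fail_bound lam \<epsilon> n\<close>.\<close>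

lemma prob_rich_upto_Suc:
  assumes "0 < lam" "0 \<le> \<epsilon>" "lam = 4 * (p - \<epsilon>)" "p \<le> 1"
  defines "N \<equiv> label_measure menger_words p"
  shows "measure N {L \<in> space N. rich_upto lam n L} * (1 - fail_bound lam \<epsilon> n)
    \<le> measure N {L \<in> space N. rich_upto lam (Suc n) L}"
proof -
  interpret prob_space N unfolding N_def by (rule prob_space_label_measure)
  let ?R = "range (\<lambda>x. {v \<in> words (Suc n). hit v x})"
  let ?F = "\<lambda>S L. \<exists>V\<in>?R. failure lam n S V L"
  let ?G = "\<lambda>S L. rich_upto lam n L \<and> surviving_words L n = S"
  have R: "V \<in> ?R \<Longrightarrow> V \<subseteq> words (Suc n)" for V by auto
  have measF: "{L \<in> space N. failure lam n S V L} \<in> sets N" if "V \<in> ?R" for S V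
    unfolding N_def by (rule measurable_failure[OF R[OF that]])
  have FUn: "{L \<in> space N. ?F S L} = (\<Union>V\<in>?R. {L \<in> space N. failure lam n S V L})" for S
    by blast
  have measF': "{L \<in> space N. ?F S L} \<in> sets N" for S
    unfolding FUn using hit_patterns(1) measF by (intro sets.finite_UN) auto
  have measG: "{L \<in> space N. ?G S L} \<in> sets N" for S
    unfolding N_def
    by (rule sets.sets_Collect_conj[OF measurable_surviving_words[where Q = "\<lambda>S'. S' = S"] measurable_rich_upto])
  have measGF: "{L \<in> space N. ?G S L \<and> ?F S L} \<in> sets N" for S
    by (rule sets.sets_Collect_conj[OF measF' measG])
  have probF: "prob {L \<in> space N. ?F S L} \<le> fail_bound lam \<epsilon> n" for S
  proof -
    have "prob {L \<in> space N. ?F S L} \<le> (\<Sum>V\<in>?R. prob {L \<in> space N. failure lam n S V L})"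
      unfolding FUn using hit_patterns(1) measF by (intro finite_measure_subadditive_finite) auto
    also have "\<dots> \<le> (\<Sum>V\<in>?R. exp (- (8 * \<epsilon>\<^sup>2 * lam ^ n)))"
      unfolding N_def by (intro sum_mono prob_failure R assms)
    also have "\<dots> = real (card ?R) * exp (- (8 * \<epsilon>\<^sup>2 * lam ^ n))" by simp
    also have "\<dots> \<le> fail_bound lam \<epsilon> n"
      unfolding fail_bound_def
    proof (intro mult_right_mono)
      have "real (card ?R) \<le> real ((card menger_digits ^ Suc n + 1)\<^sup>2)"
        using hit_patterns(2) by (intro of_nat_mono)
      then show "real (card ?R) \<le> (real (card menger_digits) ^ Suc n + 1)\<^sup>2"
        by (simp add: add.commute)
    qed simp
    finally show ?thesis .
  qed
  have indep: "prob {L \<in> space N. ?G S L \<and> ?F S L} = prob {L \<in> space N. ?G S L} * prob {L \<in> space N. ?F S L}" for S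
    unfolding N_def
  proof (rule prob_label_conj[where K = "short_words n" and K' = "words (Suc n)"])
    show "determined_by (short_words n) (?G S)"
      using determined_by_rich_upto[of n lam] determined_by_surviving_words[OF order_refl, where Q = "\<lambda>S'. S' = S"]
      unfolding determined_by_def by blast
    show "determined_by (words (Suc n)) (?F S)"
      unfolding determined_by_def
    proof (intro allI impI bex_cong refl)
      fix L L' :: "(real^3) list \<Rightarrow> bool" and V
      assume "\<forall>w\<in>words (Suc n). L w = L' w" "V \<in> ?R"
      then have "{v \<in> {v \<in> V. butlast v \<in> S}. L v} = {v \<in> {v \<in> V. butlast v \<in> S}. L' v}"
        by blast
      then show "failure lam n S V L = failure lam n S V L'" unfolding failure_def by presburger
    qed
    show "short_words n \<inter> words (Suc n) = {}" by (auto simp: short_words_def words_def)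
  qed (use short_words_subset words_subset_menger_words measF' measG in \<open>auto simp: N_def\<close>)
  have fin: "finite (Pow (words n))" using finite_words by simp
  have "prob {L \<in> space N. rich_upto lam n L \<and> \<not> rich_upto lam (Suc n) L}
      \<le> prob (\<Union>S\<in>Pow (words n). {L \<in> space N. ?G S L \<and> ?F S L})"
  proof (rule finite_measure_mono)
    show "{L \<in> space N. rich_upto lam n L \<and> \<not> rich_upto lam (Suc n) L} \<subseteq>
        (\<Union>S\<in>Pow (words n). {L \<in> space N. ?G S L \<and> ?F S L})"
    proof clarify
      fix L assume L: "L \<in> space N" "rich_upto lam n L" "\<not> rich_upto lam (Suc n) L"
      then have "rich lam n (surviving_words L n)" "\<not> rich lam (Suc n) (surviving_words L (Suc n))"
        by (auto simp: rich_upto_def le_Suc_eq)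
      from failure_if_not_rich[OF this] L surviving_words_subset[of L n]
      show "L \<in> (\<Union>S\<in>Pow (words n). {L \<in> space N. ?G S L \<and> ?F S L})" by blast
    qed
    show "(\<Union>S\<in>Pow (words n). {L \<in> space N. ?G S L \<and> ?F S L}) \<in> sets N"
      by (rule sets.finite_UN[OF fin measGF])
  qed
  also have "\<dots> \<le> (\<Sum>S\<in>Pow (words n). prob {L \<in> space N. ?G S L \<and> ?F S L})"
    by (rule finite_measure_subadditive_finite[OF fin]) (use measGF in blast)
  also have "\<dots> \<le> (\<Sum>S\<in>Pow (words n). prob {L \<in> space N. ?G S L} * fail_bound lam \<epsilon> n)"
    unfolding indep by (intro sum_mono mult_left_mono probF) simp
  also have "\<dots> = (\<Sum>S\<in>Pow (words n). prob {L \<in> space N. ?G S L}) * fail_bound lam \<epsilon> n"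
    by (simp add: sum_distrib_right)
  also have "(\<Sum>S\<in>Pow (words n). prob {L \<in> space N. ?G S L}) = prob (\<Union>S\<in>Pow (words n). {L \<in> space N. ?G S L})"
    using fin measG by (intro finite_measure_finite_Union[symmetric]) (auto simp: disjoint_family_on_def)
  also have "(\<Union>S\<in>Pow (words n). {L \<in> space N. ?G S L}) = {L \<in> space N. rich_upto lam n L}"
    using surviving_words_subset by auto
  finally have bound: "prob {L \<in> space N. rich_upto lam n L \<and> \<not> rich_upto lam (Suc n) L}
      \<le> prob {L \<in> space N. rich_upto lam n L} * fail_bound lam \<epsilon> n" .
  have meas: "{L \<in> space N. rich_upto lam k L} \<in> sets N" for k
    unfolding N_def by (rule measurable_rich_upto)
  have "{L \<in> space N. rich_upto lam n L \<and> \<not> rich_upto lam (Suc n) L} =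
      {L \<in> space N. rich_upto lam n L} - {L \<in> space N. rich_upto lam (Suc n) L}" by blast
  moreover have "{L \<in> space N. rich_upto lam (Suc n) L} \<subseteq> {L \<in> space N. rich_upto lam n L}"
    by (auto simp: rich_upto_def)
  ultimately have "prob {L \<in> space N. rich_upto lam n L \<and> \<not> rich_upto lam (Suc n) L} =
      prob {L \<in> space N. rich_upto lam n L} - prob {L \<in> space N. rich_upto lam (Suc n) L}"
    using finite_measure_Diff[OF meas meas] by simp
  with bound show ?thesis by (simp add: algebra_simps)
qed

lemma summable_fail_bound:
  assumes "1 < lam" "0 < \<epsilon>" shows "summable (fail_bound lam \<epsilon>)"
proof (rule summable_comparison_test_ev)
  define K :: real where "K = real (card menger_digits)"
  define \<kappa> where "\<kappa> = 8 * \<epsilon>\<^sup>2"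
  have \<kappa>: "\<kappa> > 0" using assms by (simp add: \<kappa>_def)
  have K: "K \<ge> 4" using card_menger_digits_ge by (simp add: K_def)
  \<comment> \<open>The extra factor \<open>2 ^ n\<close> prepares the comparison with the geometric
    series of ratio 1/2.\<close>
  have "(\<lambda>n::nat. (K ^ Suc n + 1)\<^sup>2 * exp (- (\<kappa> * lam ^ n)) * 2 ^ n) \<longlonglongrightarrow> 0"
    using \<kappa> assms K by real_asymp
  then have "\<forall>\<^sub>F n in sequentially. (K ^ Suc n + 1)\<^sup>2 * exp (- (\<kappa> * lam ^ n)) * 2 ^ n < 1"
    by (rule order_tendstoD) simp
  then show "\<forall>\<^sub>F n in sequentially. norm (fail_bound lam \<epsilon> n) \<le> (1/2) ^ n"
    by eventually_elim (simp add: fail_bound_def K_def \<kappa>_def field_simps)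
qed (simp add: summable_geometric)

lemma prob_rich_pos:
  assumes "1/4 < p" "p < 1"
  defines "N \<equiv> label_measure menger_words p" and "lam \<equiv> (4 * p + 1) / 2"
  shows "0 < measure N {L \<in> space N. \<forall>n. rich lam n (surviving_words L n)}"
proof -
  interpret prob_space N unfolding N_def by (rule prob_space_label_measure)
  \<comment> \<open>\<open>lam\<close> is the midpoint of 1 and \<open>4 * p\<close>, and
    \<open>\<epsilon>\<close> solves \<open>lam = 4 * (p - \<epsilon>)\<close>.\<close>
  define \<epsilon> where "\<epsilon> = (4 * p - 1) / 8"
  have lam: "1 < lam" "lam \<le> 4" "lam = 4 * (p - \<epsilon>)" and \<epsilon>: "0 < \<epsilon>"
    using assms by (auto simp: lam_def \<epsilon>_def field_simps)
  let ?P = "\<lambda>n. prob {L \<in> space N. rich_upto lam n L}"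
  have meas: "{L \<in> space N. rich_upto lam k L} \<in> sets N" for k
    unfolding N_def by (rule measurable_rich_upto)
  have fb: "0 \<le> fail_bound lam \<epsilon> n" for n by (simp add: fail_bound_def)
  have sum: "summable (fail_bound lam \<epsilon>)" using lam \<epsilon> by (intro summable_fail_bound)
  from suminf_exist_split[OF _ sum, of "1/2"]
  obtain m where "norm (\<Sum>i. fail_bound lam \<epsilon> (i + m)) < 1/2" by auto
  then have tail: "(\<Sum>i. fail_bound lam \<epsilon> (i + m)) < 1/2" by simp
  have part: "(\<Sum>i<k. fail_bound lam \<epsilon> (i + m)) \<le> 1/2" for k
    using sum_le_suminf[of "\<lambda>i. fail_bound lam \<epsilon> (i + m)" "{..<k}"] sum fb tail
    by (simp add: summable_iff_shift)
  have decr: "?P j \<le> ?P i" if "i \<le> j" for i j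
    by (rule finite_measure_mono[OF _ meas]) (use that in \<open>auto simp: rich_upto_def\<close>)
  \<comment> \<open>As \<open>?P\<close> decreases, the loss at each level beyond \<open>m\<close>
    is at most \<open>?P m\<close> times \<open>fail_bound\<close>. By the choice of
    \<open>m\<close> these losses add up to at most half of \<open>?P m\<close>.\<close>
  have step: "?P (k + m) \<ge> ?P m * (1 - (\<Sum>i<k. fail_bound lam \<epsilon> (i + m)))" for k
  proof (induction k)
    case (Suc k)
    have "?P m * (1 - (\<Sum>i<Suc k. fail_bound lam \<epsilon> (i + m))) =
        ?P m * (1 - (\<Sum>i<k. fail_bound lam \<epsilon> (i + m))) - ?P m * fail_bound lam \<epsilon> (k + m)"
      by (simp add: algebra_simps)
    also have "\<dots> \<le> ?P (k + m) - ?P (k + m) * fail_bound lam \<epsilon> (k + m)"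
      using Suc fb decr[of m "k + m"] by (intro diff_mono mult_right_mono) auto
    also have "\<dots> \<le> ?P (Suc k + m)"
      using prob_rich_upto_Suc[OF _ _ lam(3), of "k + m", folded N_def] lam(1) \<epsilon> assms(2)
      by (simp add: right_diff_distrib)
    finally show ?case .
  qed simp
  have half: "?P n \<ge> ?P m / 2" for n
  proof -
    have "?P m / 2 \<le> ?P m * (1 - (\<Sum>i<n. fail_bound lam \<epsilon> (i + m)))"
      using mult_left_mono[of "1/2" "1 - (\<Sum>i<n. fail_bound lam \<epsilon> (i + m))" "?P m"] part[of n] by simp
    also have "\<dots> \<le> ?P (n + m)" by (rule step)
    also have "\<dots> \<le> ?P n" by (rule decr) simp
    finally show ?thesis .
  qed
  have "0 < p ^ card (short_words m)" using assms by simp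
  also have "\<dots> = prob {L \<in> space N. \<forall>w\<in>short_words m. L w}"
    unfolding N_def using assms by (intro prob_all_labels[symmetric] finite_short_words short_words_subset) auto
  also have "\<dots> \<le> ?P m"
  proof (rule finite_measure_mono[OF _ meas])
    show "{L \<in> space N. \<forall>w\<in>short_words m. L w} \<subseteq> {L \<in> space N. rich_upto lam m L}"
      using rich_words[of lam] lam by (auto simp: rich_upto_def surviving_words_all[of m])
  qed
  finally have "0 < ?P m" .
  have "(\<lambda>n. ?P n) \<longlonglongrightarrow> prob (\<Inter>n. {L \<in> space N. rich_upto lam n L})"
  proof (rule finite_Lim_measure_decseq)
    show "range (\<lambda>n. {L \<in> space N. rich_upto lam n L}) \<subseteq> sets N" using meas by blast
    show "decseq (\<lambda>n. {L \<in> space N. rich_upto lam n L})"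
      unfolding decseq_def rich_upto_def by (blast intro: order_trans)
  qed
  then have "?P m / 2 \<le> prob (\<Inter>n. {L \<in> space N. rich_upto lam n L})"
    by (rule LIMSEQ_le_const) (intro exI allI impI half)
  also have "(\<Inter>n. {L \<in> space N. rich_upto lam n L}) = {L \<in> space N. \<forall>n. rich lam n (surviving_words L n)}"
    by (auto simp: rich_upto_def)
  finally show ?thesis using \<open>0 < ?P m\<close> by simp
qed

lemma contains_interval_if_rich:
  assumes "0 < lam" "\<And>n. rich lam n (surviving_words L n)"
  shows "contains_interval (proj (a, b, c) ` menger_sponge L)" and "non_extinct L"
proof -
  have "\<exists>w\<in>surviving_words L n. hit w x" if "\<bar>x - \<mu>\<bar> \<le> \<rho>" for n x
  proof -
    have "lam ^ n \<le> real (card {w \<in> surviving_words L n. hit w x})"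
      using assms(2) that by (simp add: rich_def)
    then have "card {w \<in> surviving_words L n. hit w x} \<noteq> 0"
      using zero_less_power[OF assms(1), of n] by linarith
    then show ?thesis by (metis (no_types, lifting) card.empty empty_Collect_eq)
  qed
  note hit = this
  have "{\<mu>-\<rho>..\<mu>+\<rho>} \<subseteq> proj (a, b, c) ` menger_sponge L"
    using hit by (intro subsetI mem_proj_menger_sponge) (auto simp: abs_le_iff)
  then show "contains_interval (proj (a, b, c) ` menger_sponge L)"
    unfolding contains_interval_def using rho_pos
    by (intro exI[of _ "{\<mu>-\<rho>..\<mu>+\<rho>}"] conjI bexI[of _ \<mu>] bexI[of _ "\<mu>+\<rho>"])
      (auto simp: is_interval_cc)
  show "non_extinct L" using hit[of \<mu>] rho_pos by (auto simp: non_extinct_def)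
qed

end

section \<open>Almost sure behaviour on non-extinction\<close>

text \<open>Equivalently, some surviving word of length \<open>k\<close> roots a subtree with
  property \<open>G\<close>. Recursion on the first letter matches \<open>non_extinct_step\<close>
  and the independence of the subtrees.\<close>

primrec descendant ::
  "(((real^3) list \<Rightarrow> bool) \<Rightarrow> bool) \<Rightarrow> nat \<Rightarrow> ((real^3) list \<Rightarrow> bool) \<Rightarrow> bool" where
  "descendant G 0 L \<longleftrightarrow> G L"
| "descendant G (Suc k) L \<longleftrightarrow> (\<exists>t\<in>menger_digits. L [t] \<and> descendant G k (\<lambda>v. L (t # v)))"

lemma Cons_menger_words: "t \<in> menger_digits \<Longrightarrow> w \<in> menger_words \<Longrightarrow> t # w \<in> menger_words"
  and single_menger_words: "t \<in> menger_digits \<Longrightarrow> [t] \<in> menger_words"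
  by (auto simp: menger_words_def)

lemma determined_by_subtree:
  assumes "determined_by menger_words E"
  shows "determined_by ((#) t ` menger_words) (\<lambda>L. E (\<lambda>v. L (t # v)))"
  using assms unfolding determined_by_def by simp

lemma measurable_label:
  "w \<in> W \<Longrightarrow> {L \<in> space (label_measure W p). L w} \<in> sets (label_measure W p)"
  by (rule measurable_label_pred[of "{w}"]) (auto simp: determined_by_def)

lemma measurable_subtree:
  assumes "t \<in> menger_digits" "determined_by menger_words E"
    and "{L \<in> space (label_measure menger_words p). E L} \<in> sets (label_measure menger_words p)"
  shows "{L \<in> space (label_measure menger_words p). E (\<lambda>v. L (t # v))} \<in> sets (label_measure menger_words p)"
  by (rule measurable_label_reindex[OF _ _ assms(2,3)]) (use Cons_menger_words[OF assms(1)] in \<open>auto intro: inj_onI\<close>)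

lemma prob_subtree:
  assumes "t \<in> menger_digits" "determined_by menger_words E"
    and "{L \<in> space (label_measure menger_words p). E L} \<in> sets (label_measure menger_words p)"
  shows "measure (label_measure menger_words p) {L \<in> space (label_measure menger_words p). E (\<lambda>v. L (t # v))} =
    measure (label_measure menger_words p) {L \<in> space (label_measure menger_words p). E L}"
  by (rule prob_label_reindex[OF _ _ assms(2,3)]) (use Cons_menger_words[OF assms(1)] in \<open>auto intro: inj_onI\<close>)

lemma determined_by_descendant:
  assumes "determined_by menger_words G"
  shows "determined_by menger_words (descendant G k)"
proof (induction k)
  case 0
  show ?case using assms by (simp add: determined_by_def)
next
  case (Suc k)
  show ?case unfolding determined_by_def
  proof (intro allI impI)
    fix L L' :: "(real^3) list \<Rightarrow> bool" assume eq: "\<forall>w\<in>menger_words. L w = L' w"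
    have "L [t] = L' [t] \<and> descendant G k (\<lambda>v. L (t # v)) = descendant G k (\<lambda>v. L' (t # v))"
      if "t \<in> menger_digits" for t
      using eq that Suc[unfolded determined_by_def] by (simp add: Cons_menger_words single_menger_words)
    then show "descendant G (Suc k) L = descendant G (Suc k) L'" by simp
  qed
qed

lemma measurable_descendant:
  assumes "determined_by menger_words G"
    and "{L \<in> space (label_measure menger_words p). G L} \<in> sets (label_measure menger_words p)"
  shows "{L \<in> space (label_measure menger_words p). descendant G k L} \<in> sets (label_measure menger_words p)"
proof (induction k)
  case 0
  show ?case using assms(2) by simp
next
  case (Suc k)
  have "{L \<in> space (label_measure menger_words p). descendant G (Suc k) L} =
    (\<Union>t\<in>menger_digits. {L \<in> space (label_measure menger_words p). L [t]} \<inter>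
      {L \<in> space (label_measure menger_words p). descendant G k (\<lambda>v. L (t # v))})"
    by auto
  also have "\<dots> \<in> sets (label_measure menger_words p)"
    by (intro sets.finite_UN sets.Int finite_menger_digits measurable_label single_menger_words
        measurable_subtree determined_by_descendant assms(1) Suc)
  finally show ?case .
qed

lemma determined_by_non_extinct: "determined_by menger_words non_extinct"
proof -
  have "determined_by menger_words (\<lambda>L. surviving_words L n \<noteq> {})" for n
    using determined_by_mono[OF determined_by_surviving_words[OF order_refl, where Q = "\<lambda>S. S \<noteq> {}"] short_words_subset] .
  then show ?thesis unfolding determined_by_def non_extinct_def by blast
qed

lemma measurable_non_extinct:
  "{L \<in> space (label_measure menger_words p). non_extinct L} \<in> sets (label_measure menger_words p)"
  unfolding non_extinct_def
  by (intro sets.sets_Collect_countable_All measurable_surviving_words[where Q = "\<lambda>S. S \<noteq> {}"])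

text \<open>The label of \<open>[t]\<close> and all labels below it form a block, and blocks of
  different digits are disjoint; hence the power. Within a block, the label of \<open>[t]\<close> is
  independent of the subtree, which has the law of the whole tree; hence the factor
  \<open>p\<close>.\<close>

lemma prob_no_child:
  fixes p :: real
  assumes "determined_by menger_words E" "0 \<le> p" "p \<le> 1" "menger_digits \<noteq> {}"
  defines "N \<equiv> label_measure menger_words p"
  assumes "{L \<in> space N. E L} \<in> sets N"
  shows "measure N {L \<in> space N. \<forall>t\<in>menger_digits. \<not> (L [t] \<and> E (\<lambda>v. L (t # v)))} =
    (1 - p * measure N {L \<in> space N. E L}) ^ card menger_digits"
proof -
  interpret prob_space N unfolding N_def by (rule prob_space_label_measure)
  have meas: "{L \<in> space N. L [t] \<and> E (\<lambda>v. L (t # v))} \<in> sets N" if "t \<in> menger_digits" for t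
    using measurable_label[OF single_menger_words[OF that]]
      measurable_subtree[OF that assms(1) assms(6)[unfolded N_def]]
    unfolding N_def by (rule sets.sets_Collect_conj[rotated])
  have single: "prob {L \<in> space N. \<not> (L [t] \<and> E (\<lambda>v. L (t # v)))} = 1 - p * prob {L \<in> space N. E L}"
    if t: "t \<in> menger_digits" for t
  proof -
    have "prob {L \<in> space N. L [t] \<and> E (\<lambda>v. L (t # v))} =
        prob {L \<in> space N. L [t]} * prob {L \<in> space N. E (\<lambda>v. L (t # v))}"
      unfolding N_def
    proof (rule prob_label_conj[where K = "{[t]}" and K' = "(#) t ` menger_words"])
      \<comment> \<open>\<open>menger_words\<close> omits the empty word, which keeps
        \<open>[t]\<close> out of the labels of its own subtree.\<close>
      show "{[t]} \<inter> (#) t ` menger_words = {}" by (auto simp: menger_words_def)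
      show "determined_by {[t]} (\<lambda>L. L [t])" by (simp add: determined_by_def)
      show "determined_by ((#) t ` menger_words) (\<lambda>L. E (\<lambda>v. L (t # v)))"
        by (rule determined_by_subtree[OF assms(1)])
    qed (use t assms(1,6) in \<open>auto simp: N_def Cons_menger_words single_menger_words
          intro!: measurable_label measurable_subtree\<close>)
    also have "prob {L \<in> space N. L [t]} = p"
      unfolding N_def by (rule prob_label[OF single_menger_words[OF t] assms(2,3)])
    also have "prob {L \<in> space N. E (\<lambda>v. L (t # v))} = prob {L \<in> space N. E L}"
      unfolding N_def by (rule prob_subtree[OF t assms(1) assms(6)[unfolded N_def]])
    finally show ?thesis using prob_neg[OF meas[OF t]] by simp
  qed
  have "prob {L \<in> space N. \<forall>t\<in>menger_digits. \<not> (L [t] \<and> E (\<lambda>v. L (t # v)))} =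
      (\<Prod>t\<in>menger_digits. prob {L \<in> space N. \<not> (L [t] \<and> E (\<lambda>v. L (t # v)))})"
    unfolding N_def
  proof (rule prob_label_blocks[where K = "\<lambda>t. insert [t] ((#) t ` menger_words)"])
    show "disjoint_family_on (\<lambda>t. insert [t] ((#) t ` menger_words)) menger_digits"
      by (auto simp: disjoint_family_on_def)
    show "determined_by (insert [t] ((#) t ` menger_words)) (\<lambda>L. \<not> (L [t] \<and> E (\<lambda>v. L (t # v))))" for t
      using determined_by_subtree[OF assms(1), of t] unfolding determined_by_def by (metis insertCI)
    show "{L \<in> space (label_measure menger_words p). \<not> (L [t] \<and> E (\<lambda>v. L (t # v)))}
        \<in> sets (label_measure menger_words p)" if "t \<in> menger_digits" for t
      using sets.sets_Collect_neg[OF meas[OF that]] unfolding N_def .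
  qed (use finite_menger_digits assms(4) in \<open>auto intro: Cons_menger_words single_menger_words\<close>)
  also have "\<dots> = (\<Prod>t\<in>menger_digits. 1 - p * prob {L \<in> space N. E L})"
    by (intro prod.cong refl single)
  finally show ?thesis by simp
qed

text \<open>Applied to the probability \<open>u\<close> of having no good descendant and the extinction probability \<open>q\<close>:
  by strict convexity the generating function has no fixed point in between \<open>q\<close> and 1.\<close>

lemma power_fixed_point_le:
  fixes p q u :: real
  assumes "0 < p" "p < 1" "2 \<le> n" "0 \<le> q" "u < 1"
    and u: "u \<le> (1 - p * (1 - u)) ^ n" and q: "q = (1 - p * (1 - q)) ^ n"
  shows "u \<le> q"
proof (rule ccontr)
  assume "\<not> u \<le> q"
  then have less: "q < u" by simp
  define x y where "x = 1 - p * (1 - u)" and "y = 1 - p * (1 - q)"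
  have "p * (1 - q) \<le> p * 1" using assms(1,4) by (intro mult_left_mono) auto
  then have y: "0 < y" using assms(2) unfolding y_def by linarith
  have "p * (1 - u) < p * (1 - q)" using less assms by simp
  then have xy: "y < x" by (simp add: x_def y_def)
  have x: "x < 1" using assms by (simp add: x_def)
  \<comment> \<open>The secant of the generating function over the interval from \<open>u\<close> to
    1 has slope at most 1.\<close>
  have "1 - u \<ge> 1 - x ^ n" using u by (simp add: x_def)
  also have "1 - x ^ n = (1 - x) * (\<Sum>i<n. x ^ i)" by (rule one_diff_power_eq)
  also have "\<dots> = (1 - u) * (p * (\<Sum>i<n. x ^ i))" by (simp add: x_def)
  finally have A: "p * (\<Sum>i<n. x ^ i) \<le> 1" using assms by simp
  \<comment> \<open>The secant from \<open>q\<close> to \<open>u\<close> has slope at least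
    1.\<close>
  have "u - q \<le> x ^ n - y ^ n" using u q by (simp add: x_def y_def)
  also have "\<dots> = (x - y) * (\<Sum>i<n. y ^ (n - Suc i) * x ^ i)" by (rule power_diff_sumr2)
  also have "x - y = (u - q) * p" by (simp add: x_def y_def algebra_simps)
  finally have "(u - q) * 1 \<le> (u - q) * (p * (\<Sum>i<n. y ^ (n - Suc i) * x ^ i))"
    by (simp add: mult.assoc)
  then have B: "1 \<le> p * (\<Sum>i<n. y ^ (n - Suc i) * x ^ i)" using less by simp
  \<comment> \<open>Strict convexity: since \<open>y < 1\<close>, the second slope is below the
    first. Strictness comes from the term \<open>i = 0\<close>, where the exponent
    \<open>n - 1\<close> of \<open>y\<close> is positive because \<open>2 \<le> n\<close>.\<close>
  have "(\<Sum>i<n. y ^ (n - Suc i) * x ^ i) < (\<Sum>i<n. x ^ i)"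
  proof (rule sum_strict_mono_ex1)
    show "\<forall>i\<in>{..<n}. y ^ (n - Suc i) * x ^ i \<le> x ^ i"
      using y xy x by (auto intro!: mult_left_le_one_le power_le_one)
    have "n - Suc 0 = Suc (n - 2)" using assms(3) by simp
    then have "y ^ (n - Suc 0) < 1" using power_Suc_less_one[of y "n - 2"] y xy x by simp
    then show "\<exists>i\<in>{..<n}. y ^ (n - Suc i) * x ^ i < x ^ i"
      using assms(3) by (intro bexI[of _ 0]) auto
  qed simp
  then have "p * (\<Sum>i<n. y ^ (n - Suc i) * x ^ i) < p * (\<Sum>i<n. x ^ i)" using assms by simp
  with A B show False by simp
qed

lemma descendant_non_extinct:
  assumes "\<And>L. G L \<Longrightarrow> non_extinct L"
  shows "descendant G k L \<Longrightarrow> non_extinct L"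
  by (induction k arbitrary: L) (auto simp: assms intro: non_extinct_step[THEN iffD2])

text \<open>Both the probability \<open>?u\<close> of no good descendant and the extinction
  probability \<open>?q\<close> are compared with the same generating function, and
  \<open>pos\<close> excludes \<open>?u = 1\<close>; so \<open>?u \<le> ?q\<close>. Since a good
  descendant implies non-extinction, the two events agree up to a null set.\<close>

lemma AE_descendant:
  fixes p :: real
  assumes p: "0 < p" "p < 1" and D: "2 \<le> card menger_digits"
  defines "N \<equiv> label_measure menger_words p"
  assumes G: "determined_by menger_words G" "{L \<in> space N. G L} \<in> sets N"
    and pos: "0 < measure N {L \<in> space N. G L}" and ne: "\<And>L. G L \<Longrightarrow> non_extinct L"
  shows "AE L in N. non_extinct L \<longrightarrow> (\<exists>k. descendant G k L)"
proof -
  interpret prob_space N unfolding N_def by (rule prob_space_label_measure)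
  define H where "H L \<longleftrightarrow> (\<exists>k. descendant G k L)" for L
  have D0: "menger_digits \<noteq> {}" using D by auto
  have detH: "determined_by menger_words H"
    using determined_by_descendant[OF G(1)] unfolding determined_by_def H_def by blast
  have measH: "{L \<in> space N. H L} \<in> sets N"
    unfolding H_def N_def
    by (intro sets.sets_Collect_countable_Ex measurable_descendant G[unfolded N_def])
  have measE: "{L \<in> space N. non_extinct L} \<in> sets N"
    unfolding N_def by (rule measurable_non_extinct)
  let ?u = "prob {L \<in> space N. \<not> H L}" and ?q = "prob {L \<in> space N. \<not> non_extinct L}"
  have u: "?u = 1 - prob {L \<in> space N. H L}" and q: "?q = 1 - prob {L \<in> space N. non_extinct L}"
    by (rule prob_neg[OF measH] prob_neg[OF measE])+
  have "{L \<in> space N. G L} \<subseteq> {L \<in> space N. H L}"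
    unfolding H_def by (auto intro: exI[of _ 0])
  then have "prob {L \<in> space N. G L} \<le> prob {L \<in> space N. H L}"
    by (rule finite_measure_mono[OF _ measH])
  with pos u have u1: "?u < 1" by simp
  have "?u \<le> ?q"
  proof (rule power_fixed_point_le[OF p D _ u1])
    show "0 \<le> ?q" by simp
    \<comment> \<open>Only an inequality, because \<open>H\<close> may hold through \<open>G\<close>
      at the root without passing to a child.\<close>
    have "?u \<le> prob {L \<in> space N. \<forall>t\<in>menger_digits. \<not> (L [t] \<and> H (\<lambda>v. L (t # v)))}"
    proof (rule finite_measure_mono)
      show "{L \<in> space N. \<not> H L} \<subseteq> {L \<in> space N. \<forall>t\<in>menger_digits. \<not> (L [t] \<and> H (\<lambda>v. L (t # v)))}"
      proof safe
        fix L t assume "\<not> H L" "t \<in> menger_digits" "L [t]" "H (\<lambda>v. L (t # v))"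
        then obtain k where "descendant G (Suc k) L" by (auto simp: H_def)
        with \<open>\<not> H L\<close> show False unfolding H_def by blast
      qed
      have "{L \<in> space N. L [t] \<and> H (\<lambda>v. L (t # v))} \<in> sets N" if "t \<in> menger_digits" for t
        unfolding N_def
        by (rule sets.sets_Collect_conj[OF measurable_subtree[OF that detH measH[unfolded N_def]]
              measurable_label[OF single_menger_words[OF that]]])
      then show "{L \<in> space N. \<forall>t\<in>menger_digits. \<not> (L [t] \<and> H (\<lambda>v. L (t # v)))} \<in> sets N"
        by (intro sets.sets_Collect_finite_All sets.sets_Collect_neg finite_menger_digits)
    qed
    also have "\<dots> = (1 - p * (1 - ?u)) ^ card menger_digits"
      using prob_no_child[OF detH _ _ D0 measH[unfolded N_def]] p u by (simp add: N_def)
    finally show "?u \<le> (1 - p * (1 - ?u)) ^ card menger_digits" .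
    have "?q = prob {L \<in> space N. \<forall>t\<in>menger_digits. \<not> (L [t] \<and> non_extinct (\<lambda>v. L (t # v)))}"
      using non_extinct_step by (intro arg_cong[where f = prob]) blast
    also have "\<dots> = (1 - p * (1 - ?q)) ^ card menger_digits"
      using prob_no_child[OF determined_by_non_extinct _ _ D0 measE[unfolded N_def]] p q
      by (simp add: N_def)
    finally show "?q = (1 - p * (1 - ?q)) ^ card menger_digits" .
  qed
  then have "prob {L \<in> space N. non_extinct L} \<le> prob {L \<in> space N. H L}" using u q by simp
  moreover have sub: "{L \<in> space N. H L} \<subseteq> {L \<in> space N. non_extinct L}"
    using descendant_non_extinct[OF ne] by (auto simp: H_def)
  ultimately have "prob ({L \<in> space N. non_extinct L} - {L \<in> space N. H L}) = 0"
    using finite_measure_Diff[OF measE measH sub] finite_measure_mono[OF sub measE] by simp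
  moreover have "{L \<in> space N. non_extinct L} - {L \<in> space N. H L} \<in> sets N"
    using measE measH by (rule sets.Diff)
  ultimately have "AE L in N. L \<notin> {L \<in> space N. non_extinct L} - {L \<in> space N. H L}"
    by (intro AE_not_in null_setsI) (auto simp: emeasure_eq_measure)
  then show ?thesis by (rule AE_mp) (auto simp: H_def)
qed

section \<open>Transfer from the product space to arbitrary labels\<close>

lemma menger_sponge_cong:
  assumes "\<And>w. w \<in> menger_words \<Longrightarrow> L w = L' w"
  shows "menger_sponge L = menger_sponge L'" and "non_extinct L = non_extinct L'"
proof -
  have "surviving_words L n = surviving_words L' n" for n
    using short_words_subset assms by (intro surviving_words_cong) blast
  then show "menger_sponge L = menger_sponge L'" "non_extinct L = non_extinct L'"
    by (simp_all add: menger_sponge_def non_extinct_def)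
qed

text \<open>Independence means that the joint law is the product of the marginals. Hence almost sure
  statements about \<open>label_measure\<close> can be pulled back to \<open>M\<close>.\<close>

lemma distr_bernoulli_labelling:
  assumes "prob_space M" "bernoulli_labelling M p X" "menger_words \<noteq> {}"
  shows "(\<lambda>\<omega>. \<lambda>w\<in>menger_words. X w \<omega>) \<in> M \<rightarrow>\<^sub>M label_measure menger_words p" (is ?A)
    and "distr M (label_measure menger_words p) (\<lambda>\<omega>. \<lambda>w\<in>menger_words. X w \<omega>) =
      label_measure menger_words p" (is ?B)
proof -
  interpret prob_space M by fact
  have indep: "indep_vars (\<lambda>_. count_space UNIV) X menger_words"
    and dist: "\<And>w. w \<in> menger_words \<Longrightarrow> distr M (count_space UNIV) (X w) = measure_pmf (bernoulli_pmf p)"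
    using assms(2) by (auto simp: bernoulli_labelling_def)
  have rv: "random_variable (count_space UNIV) (X w)" if "w \<in> menger_words" for w
    using indep that by (auto simp: indep_vars_def)
  show ?A unfolding measurable_cong_sets[OF refl sets_label_measure]
    using rv by (rule measurable_restrict)
  have "distr M (label_measure menger_words p) (\<lambda>\<omega>. \<lambda>w\<in>menger_words. X w \<omega>) =
      distr M (\<Pi>\<^sub>M w\<in>menger_words. count_space UNIV) (\<lambda>\<omega>. \<lambda>w\<in>menger_words. X w \<omega>)"
    by (intro distr_cong refl sets_label_measure)
  also have "\<dots> = (\<Pi>\<^sub>M w\<in>menger_words. distr M (count_space UNIV) (X w))"
    using indep_vars_iff_distr_eq_PiM'[where M' = "\<lambda>_. count_space UNIV" and X = X, OF assms(3)] rv indep by simp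
  also have "\<dots> = label_measure menger_words p"
    unfolding label_measure_def by (intro PiM_cong refl dist)
  finally show ?B .
qed

theorem theorem1p15:
  fixes M :: "'w measure" and X :: "(real^3) list \<Rightarrow> 'w \<Rightarrow> bool"
    and a b c p :: real
  assumes "prob_space M"
    and "bernoulli_labelling M p X"
    and "(a, b, c) \<noteq> (0, 0, 0)"
    and "0 < p" and "p < 1"
    and "p > 0.25"
  shows "AE \<omega> in M. non_extinct (\<lambda>w. X w \<omega>) \<longrightarrow>
           contains_interval (proj (a, b, c) ` menger_sponge (\<lambda>w. X w \<omega>))"
proof -
  from robust_nonzero[OF assms(3)] obtain \<rho> where \<rho>: "\<rho> > 0" "2 * \<rho> \<le> \<bar>a\<bar> + \<bar>b\<bar> + \<bar>c\<bar>"
      "\<And>z. \<bar>z\<bar> \<le> 3 * \<rho> \<Longrightarrow> 4 \<le> card (sign_cover a b c \<rho> z)"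
    unfolding robust_def by blast
  interpret covered_projection a b c \<rho> by unfold_locales (fact \<rho>)+
  define lam where "lam = (4 * p + 1) / 2"
  define G where "G L \<longleftrightarrow> (\<forall>n. rich lam n (surviving_words L n))" for L
  let ?N = "label_measure menger_words p"
  have lam: "0 < lam" using assms by (simp add: lam_def)
  have G: "contains_interval (proj (a, b, c) ` menger_sponge L)" "non_extinct L" if "G L" for L
    using contains_interval_if_rich[OF lam] that by (auto simp: G_def)
  have "determined_by menger_words (\<lambda>L. rich lam n (surviving_words L n))" for n
    by (rule determined_by_mono[OF determined_by_surviving_words[OF order_refl] short_words_subset])
  then have detG: "determined_by menger_words G"
    unfolding determined_by_def G_def by blast
  have measG: "{L \<in> space ?N. G L} \<in> sets ?N"
    unfolding G_def by (intro sets.sets_Collect_countable_All measurable_surviving_words)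
  have pos: "0 < measure ?N {L \<in> space ?N. G L}"
    unfolding G_def lam_def using assms by (intro prob_rich_pos) auto
  have "AE L in ?N. non_extinct L \<longrightarrow> (\<exists>k. descendant G k L)"
    using assms card_menger_digits_ge by (intro AE_descendant detG measG pos G(2)) auto
  moreover have "contains_interval (proj (a, b, c) ` menger_sponge L)" if "descendant G k L" for k L
    using that
  proof (induction k arbitrary: L)
    case (Suc k)
    then show ?case by (auto intro: contains_interval_descendant)
  qed (simp add: G)
  ultimately have AE: "AE L in ?N. non_extinct L \<longrightarrow> contains_interval (proj (a, b, c) ` menger_sponge L)"
    by (auto elim!: AE_mp)
  obtain t where "t \<in> menger_digits" using card_menger_digits_ge by fastforce
  then have W: "menger_words \<noteq> {}" using single_menger_words by blast
  note X = distr_bernoulli_labelling[OF assms(1,2) W]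
  \<comment> \<open>Only the restricted labelling is a point of the product space; by
    \<open>menger_sponge_cong\<close> the restriction changes neither the sponge nor
    extinction.\<close>
  let ?X = "\<lambda>\<omega>. \<lambda>w\<in>menger_words. X w \<omega>"
  have "AE \<omega> in M. non_extinct (?X \<omega>) \<longrightarrow> contains_interval (proj (a, b, c) ` menger_sponge (?X \<omega>))"
    by (rule AE_distrD[OF X(1)]) (simp only: X(2) AE)
  moreover have "menger_sponge (?X \<omega>) = menger_sponge (\<lambda>w. X w \<omega>)"
      "non_extinct (?X \<omega>) = non_extinct (\<lambda>w. X w \<omega>)" for \<omega>
    by (rule menger_sponge_cong; simp)+
  ultimately show ?thesis by simp
qed

end
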